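(* Let $\{X_n\}_{n\in\mathbb Z}$ be a real-valued, doubly infinite, stationary and ergodic time series, and assume that for some number $D$, $|X_0|\le D<\infty$ almost surely. Let the on-line predictor $\hat R_t$ of $X_t$, based on $(X_0,\dots,X_{t-1})$, be constructed as described in the context. Then, as $t\to\infty$, $$\hat R_t-E(X_t\mid X_0^{t-1})\to0$$ in $L^1$ and in probability.
   Context: Notation: for $i\le j$, $X_i^j=(X_i,X_{i+1},\dots,X_j)$. Partitions and quantizers: $\mathcal P_k=\{A_{k,i}: i=1,\dots,m_k\}$, $k\ge1$, is a sequence of finite partitions of the real line into (finite or infinite) right semi-closed intervals such that the finite $\sigma$-algebras $\sigma(\mathcal P_k)$ are increasing in $k$ and asymptotically generate the Borel $\sigma$-field (i.e. $\bigcup_k\sigma(\mathcal P_k)$ generates it). The quantizer $G_k$ is defined by $G_k(x)=A_{k,i}$ if $x\in A_{k,i}$, and it is applied to vectors coordinatewise. Recursive construction: put $\lambda_0=1$, and for $k=1,2,\dots$ let $$\tau_k=\min\{t>0:\ G_k(X_{-\lambda_{k-1}-t}^{-1-t})=G_k(X_{-\lambda_{k-1}}^{-1})\},\qquad \lambda_k=\tau_k+\lambda_{k-1}.$$ Here $t$ ranges over positive integers; by ergodicity all $\tau_k$ are a.s. finite. Estimators: for an integer $t>0$, let $\kappa_t$ be the maximum of the integers $k\ge0$ for which $\lambda_k\le t$, and put $$\hat R_{-t}=\frac1{\kappa_t}\sum_{1\le j\le\kappa_t}X_{-\tau_j},$$ with $\hat R_{-t}=0$ if $\kappa_t=0$.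 The quantity $\hat R_{-t}$ is a function of $(X_{-t},\dots,X_{-1})$ only. The predictor $\hat R_t$ is defined by $\hat R_t(\omega)=\hat R_{-t}(T^t\omega)$, where $T$ is the left shift; that is, $\hat R_t$ is the same function of $(X_0,\dots,X_{t-1})$ as $\hat R_{-t}$ is of $(X_{-t},\dots,X_{-1})$. *)

theory Defs
  imports "HOL-Probability.Probability"
begin

section \<open>Stationary and ergodic two-sided processes\<close>

abbreviation path_space :: "(int \<Rightarrow> real) measure" where
  "path_space \<equiv> PiM UNIV (\<lambda>_. borel)"

definition left_shift :: "(int \<Rightarrow> real) \<Rightarrow> int \<Rightarrow> real" where
  "left_shift x = (\<lambda>n. x (n + 1))"

definition sample_path :: "(int \<Rightarrow> 'a \<Rightarrow> real) \<Rightarrow> 'a \<Rightarrow> int \<Rightarrow> real" where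
  "sample_path X \<omega> = (\<lambda>n. X n \<omega>)"

definition stationary :: "'a measure \<Rightarrow> (int \<Rightarrow> 'a \<Rightarrow> real) \<Rightarrow> bool" where
  "stationary M X \<longleftrightarrow>
     distr M path_space (\<lambda>\<omega>. left_shift (sample_path X \<omega>)) = distr M path_space (sample_path X)"

definition ergodic :: "'a measure \<Rightarrow> (int \<Rightarrow> 'a \<Rightarrow> real) \<Rightarrow> bool" where
  "ergodic M X \<longleftrightarrow>
     (\<forall>B \<in> sets path_space. left_shift -` B = B \<longrightarrow>
        measure M {\<omega> \<in> space M. sample_path X \<omega> \<in> B} \<in> {0, 1})"

text \<open>The \<open>\<sigma>\<close>-algebra generated by \<open>X\<^sub>0, \<dots>, X\<^sub>t\<^sub>-\<^sub>1\<close>.\<close>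

definition sigma_past :: "'a measure \<Rightarrow> (int \<Rightarrow> 'a \<Rightarrow> real) \<Rightarrow> nat \<Rightarrow> 'a measure" where
  "sigma_past M X t =
     vimage_algebra (space M) (\<lambda>\<omega>. \<lambda>i\<in>{0..<int t}. X i \<omega>) (PiM {0..<int t} (\<lambda>_. borel))"


section \<open>Nested interval partitions and quantizers\<close>

definition right_semiclosed_interval :: "real set \<Rightarrow> bool" where
  "right_semiclosed_interval A \<longleftrightarrow>
     (\<exists>a b. A = {a<..b}) \<or> (\<exists>b. A = {..b}) \<or> (\<exists>a. A = {a<..}) \<or> A = UNIV"

text \<open>Only the partitions \<open>\<P> k\<close> with \<open>k \<ge> 1\<close> are constrained and used.\<close>

definition generating_partitions :: "(nat \<Rightarrow> real set set) \<Rightarrow> bool" where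
  "generating_partitions \<P> \<longleftrightarrow>
     (\<forall>k\<ge>1. finite (\<P> k) \<and> partition_on UNIV (\<P> k) \<and>
            (\<forall>A\<in>\<P> k. right_semiclosed_interval A)) \<and>
     (\<forall>k\<ge>1. sigma_sets UNIV (\<P> k) \<subseteq> sigma_sets UNIV (\<P> (Suc k))) \<and>
     sigma_sets UNIV (\<Union>k\<in>{1..}. sigma_sets UNIV (\<P> k)) = sets borel"

definition quantizer :: "real set set \<Rightarrow> real \<Rightarrow> real set" where
  "quantizer \<Q> x = (THE A. A \<in> \<Q> \<and> x \<in> A)"


section \<open>The estimators\<close>

text \<open>
  Recurrence times take values in \<^typ>\<open>enat\<close>, so that everything is defined on every path:
  a time is \<open>\<infinity>\<close> if the block of length \<open>L\<close> ending at \<open>-1\<close> never recurs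
  or if \<open>L = \<infinity>\<close> (the infimum of the empty set being \<open>\<infinity>\<close>).
\<close>

definition recurrence_time :: "(real \<Rightarrow> real set) \<Rightarrow> (int \<Rightarrow> real) \<Rightarrow> enat \<Rightarrow> enat" where
  "recurrence_time G x L =
     Inf {enat t | t. t > 0 \<and>
        (\<exists>l. L = enat l \<and>
           map G (map x [- int l - int t .. - 1 - int t]) = map G (map x [- int l .. - 1]))}"

primrec lam :: "(nat \<Rightarrow> real set set) \<Rightarrow> (int \<Rightarrow> real) \<Rightarrow> nat \<Rightarrow> enat" where
  "lam \<P> x 0 = 1"
| "lam \<P> x (Suc k) = recurrence_time (quantizer (\<P> (Suc k))) x (lam \<P> x k) + lam \<P> x k"

text \<open>Meaningful for \<open>k \<ge> 1\<close>.\<close>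

definition tau :: "(nat \<Rightarrow> real set set) \<Rightarrow> (int \<Rightarrow> real) \<Rightarrow> nat \<Rightarrow> enat" where
  "tau \<P> x k = recurrence_time (quantizer (\<P> k)) x (lam \<P> x (k - 1))"

text \<open>
  For \<open>t \<ge> 1\<close> the set below contains \<open>0\<close>, and it is finite since \<open>lam \<P> x k > k\<close>.
\<close>

definition kappa :: "(nat \<Rightarrow> real set set) \<Rightarrow> (int \<Rightarrow> real) \<Rightarrow> nat \<Rightarrow> nat" where
  "kappa \<P> x t = Max {k. lam \<P> x k \<le> enat t}"

text \<open>All \<open>tau \<P> x j\<close> with \<open>1 \<le> j \<le> kappa \<P> x t\<close> are finite when \<open>t \<ge> 1\<close>.\<close>

definition backward_estimator :: "(nat \<Rightarrow> real set set) \<Rightarrow> nat \<Rightarrow> (int \<Rightarrow> real) \<Rightarrow> real" where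
  "backward_estimator \<P> t x =
     (if kappa \<P> x t = 0 then 0
      else (\<Sum>j = 1..kappa \<P> x t. x (- int (the_enat (tau \<P> x j)))) / real (kappa \<P> x t))"

definition online_predictor ::
    "(nat \<Rightarrow> real set set) \<Rightarrow> (int \<Rightarrow> 'a \<Rightarrow> real) \<Rightarrow> nat \<Rightarrow> 'a \<Rightarrow> real" where
  "online_predictor \<P> X t \<omega> = backward_estimator \<P> t ((left_shift ^^ t) (sample_path X \<omega>))"


section \<open>Modes of convergence to zero\<close>

text \<open>
  The Bochner integral of a non-integrable function is \<open>0\<close> and the measure of a
  non-measurable set is \<open>0\<close>, so integrability and measurability are required explicitly.
  The index \<open>t = 0\<close> is exempt because the predictor is only defined for \<open>t \<ge> 1\<close>.
\<close>

definition tendsto_0_L1 :: "'a measure \<Rightarrow> (nat \<Rightarrow> 'a \<Rightarrow> real) \<Rightarrow> bool" where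
  "tendsto_0_L1 M Y \<longleftrightarrow>
     (\<forall>t\<ge>1. integrable M (Y t)) \<and> (\<lambda>t. \<integral>\<omega>. \<bar>Y t \<omega>\<bar> \<partial>M) \<longlonglongrightarrow> 0"

definition tendsto_0_in_prob :: "'a measure \<Rightarrow> (nat \<Rightarrow> 'a \<Rightarrow> real) \<Rightarrow> bool" where
  "tendsto_0_in_prob M Y \<longleftrightarrow>
     (\<forall>t\<ge>1. Y t \<in> borel_measurable M) \<and>
     (\<forall>\<epsilon>>0. (\<lambda>t. measure M {\<omega> \<in> space M. \<bar>Y t \<omega>\<bar> > \<epsilon>}) \<longlonglongrightarrow> 0)"

end

theory Submission
  imports Defs
begin

text \<open>
  Why the theorem holds. By stationarity the error at time \<open>t\<close> has the same distribution as
  the difference of the backward estimator at \<open>t\<close> and \<open>E(X\<^sub>0 | X\<^bsub>-t\<^esub>, \<dots>, X\<^bsub>-1\<^esub>)\<close> (lemma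
  \<open>cond_exp_sigma_past\<close>). Both of these converge almost surely to \<open>E(X\<^sub>0 | \<dots>, X\<^bsub>-2\<^esub>, X\<^bsub>-1\<^esub>)\<close> and are bounded
  by \<open>D\<close>, so their difference tends to \<open>0\<close> in \<open>L\<^sup>1\<close>, and in probability by Markov's inequality.

  For the conditional expectations this is Levy's upward theorem (\<open>levy_upward\<close>). For the backward
  estimator the key is a symmetry of recurrence. Label each path by its quantized block of length
  \<open>\<lambda>\<^bsub>k-1\<^esub>\<close>. Since \<open>\<lambda>\<^bsub>k-1\<^esub>\<close> is a stopping time of the quantized past (\<open>lam_tau_cong\<close>), \<open>\<tau>\<^sub>k\<close> is the first
  time at which the backward shift brings the path back to its own label. By Poincare's recurrence
  theorem it is almost surely finite, and the map that performs this first return preserves the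
  measure (\<open>distr_return_map\<close>) while keeping each label class invariant. Hence, given the block,
  \<open>X\<^bsub>-\<tau>\<^esub>\<close> with \<open>\<tau> = \<tau>\<^sub>k\<close> has the same conditional law as \<open>X\<^sub>0\<close> (\<open>cond_exp_quantized_value\<close>).

  Consequently, up to quantization errors that vanish with the mesh of the partitions
  (\<open>mesh_tendsto_0\<close>), each term of the estimator is a martingale difference plus \<open>E(X\<^sub>0 | block)\<close>. Averages
  of the bounded martingale differences tend to \<open>0\<close> (\<open>strong_law_orthogonal\<close>). The blocks
  increase to the whole past, so the conditional expectations converge by Levy's theorem again, and
  their Cesaro means have the same limit (\<open>recurrence_averages\<close>).
\<close>

section \<open>Quantizers\<close>

lemma quantizer_eqI:
  assumes "partition_on UNIV \<Q>" "A \<in> \<Q>" "x \<in> A"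
  shows "quantizer \<Q> x = A"
  unfolding quantizer_def
proof (rule the_equality)
  fix B assume "B \<in> \<Q> \<and> x \<in> B"
  then show "B = A"
    using assms partition_onD2[OF assms(1)] unfolding disjoint_def by blast
qed (use assms in auto)

lemma quantizer_mem:
  assumes "partition_on UNIV \<Q>"
  shows "quantizer \<Q> x \<in> \<Q>" "x \<in> quantizer \<Q> x"
proof -
  obtain A where A: "A \<in> \<Q>" "x \<in> A"
    using assms unfolding partition_on_def by blast
  have "quantizer \<Q> x = A" by (rule quantizer_eqI[OF assms A])
  with A show "quantizer \<Q> x \<in> \<Q>" "x \<in> quantizer \<Q> x" by simp_all
qed

lemma quantizer_vimage:
  assumes "partition_on UNIV \<Q>" "A \<in> \<Q>"
  shows "quantizer \<Q> -` {A} = A"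
  using quantizer_eqI[OF assms] quantizer_mem(2)[OF assms(1)] by auto

lemma sigma_sets_partition_invariant:
  assumes part: "partition_on UNIV \<Q>" and "B \<in> sigma_sets UNIV \<Q>"
    and "quantizer \<Q> x = quantizer \<Q> y"
  shows "x \<in> B \<longleftrightarrow> y \<in> B"
  using assms(2)
proof induction
  case (Basic A)
  then show ?case using quantizer_eqI[OF part] quantizer_mem[OF part] assms(3) by metis
qed auto

lemma right_semiclosed_interval_convex:
  assumes "right_semiclosed_interval A" "x \<in> A" "y \<in> A" "x \<le> z" "z \<le> y"
  shows "z \<in> A"
  using assms unfolding right_semiclosed_interval_def by auto

lemma right_semiclosed_interval_borel:
  "right_semiclosed_interval A \<Longrightarrow> A \<in> sets borel"
  unfolding right_semiclosed_interval_def by auto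

locale partitions =
  fixes \<P> :: "nat \<Rightarrow> real set set"
  assumes gen: "generating_partitions \<P>"
begin

abbreviation Q :: "nat \<Rightarrow> real \<Rightarrow> real set" where
  "Q k \<equiv> quantizer (\<P> k)"

lemma finite_P: "k \<ge> 1 \<Longrightarrow> finite (\<P> k)"
  and partition_P: "k \<ge> 1 \<Longrightarrow> partition_on UNIV (\<P> k)"
  and interval_P: "k \<ge> 1 \<Longrightarrow> A \<in> \<P> k \<Longrightarrow> right_semiclosed_interval A"
  and borel_P: "k \<ge> 1 \<Longrightarrow> A \<in> \<P> k \<Longrightarrow> A \<in> sets borel"
  and sigma_P_mono: "k \<ge> 1 \<Longrightarrow> sigma_sets UNIV (\<P> k) \<subseteq> sigma_sets UNIV (\<P> (Suc k))"
  and sigma_P_borel: "sigma_sets UNIV (\<Union>k\<in>{1..}. sigma_sets UNIV (\<P> k)) = sets borel"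
  using gen right_semiclosed_interval_borel unfolding generating_partitions_def by simp_all

lemma measurable_Q: "k \<ge> 1 \<Longrightarrow> Q k \<in> borel \<rightarrow>\<^sub>M count_space (\<P> k)"
  by (subst measurable_count_space_eq_countable)
     (auto simp: quantizer_vimage partition_P borel_P quantizer_mem countable_finite finite_P)

lemma Q_refine:
  assumes "1 \<le> j" "j \<le> k" "Q k x = Q k y"
  shows "Q j x = Q j y"
  using assms(2,1,3)
proof (induction k rule: dec_induct)
  case (step k)
  have k: "1 \<le> k" using step by simp
  have "Q k x \<in> sigma_sets UNIV (\<P> (Suc k))"
    using sigma_P_mono[OF k] quantizer_mem(1)[OF partition_P[OF k]] by blast
  then have "y \<in> Q k x"
    using sigma_sets_partition_invariant[OF partition_P, of "Suc k" "Q k x" x y] step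
      quantizer_mem(2)[OF partition_P[OF k]] by auto
  then have "Q k x = Q k y"
    using quantizer_eqI[OF partition_P[OF k] quantizer_mem(1)[OF partition_P[OF k]]] by metis
  with step show ?case by blast
qed auto

text \<open>
  Distinct points are eventually separated: a pair that is never separated would be contained in,
  or disjoint from, every set of the generated \<open>\<sigma>\<close>-algebra, which contains the singletons.
\<close>

lemma Q_separates:
  assumes "x \<noteq> y"
  obtains m where "m \<ge> 1" "\<And>k. k \<ge> m \<Longrightarrow> Q k x \<noteq> Q k y"
proof -
  have "\<exists>m\<ge>1. Q m x \<noteq> Q m y"
  proof (rule ccontr)
    assume "\<not> ?thesis"
    then have same: "Q m x = Q m y" if "m \<ge> 1" for m using that by blast
    have "x \<in> B \<longleftrightarrow> y \<in> B" if "B \<in> sigma_sets UNIV (\<Union>k\<in>{1..}. sigma_sets UNIV (\<P> k))" for B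
      using that
    proof induction
      case (Basic A)
      then show ?case using sigma_sets_partition_invariant[OF partition_P _ same] by auto
    qed auto
    then have "x \<in> B \<longleftrightarrow> y \<in> B" if "B \<in> sets borel" for B
      using that sigma_P_borel by blast
    from this[of "{x}"] show False using assms by auto
  qed
  with that Q_refine show thesis by metis
qed

text \<open>
  The mesh tends to \<open>0\<close> uniformly on bounded sets: cells are convex, so it is enough that
  the finitely many neighbours on a grid of width \<open>\<epsilon>/2\<close> are separated.
\<close>

lemma mesh_tendsto_0:
  assumes "\<epsilon> > 0"
  obtains m where "m \<ge> 1"
    "\<And>k x y. k \<ge> m \<Longrightarrow> \<bar>x\<bar> \<le> D \<Longrightarrow> \<bar>y\<bar> \<le> D \<Longrightarrow> Q k x = Q k y \<Longrightarrow> \<bar>x - y\<bar> \<le> \<epsilon>"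
proof -
  define d where "d = \<epsilon> / 2"
  have d: "d > 0" using assms by (simp add: d_def)
  define g where "g i = real_of_int i * d" for i :: int
  have "\<exists>m\<ge>1. \<forall>k\<ge>m. Q k (g i) \<noteq> Q k (g (i + 1))" for i
  proof -
    have "g i \<noteq> g (i + 1)" using d by (simp add: g_def)
    then show ?thesis by (rule Q_separates) blast
  qed
  then obtain m where m: "\<And>i. m i \<ge> 1" "\<And>i k. k \<ge> m i \<Longrightarrow> Q k (g i) \<noteq> Q k (g (i + 1))"
    by metis
  define I where "I = {\<lfloor>- D / d\<rfloor> - 1 .. \<lceil>D / d\<rceil> + 1}"
  define n where "n = Max (insert 1 (m ` I))"
  have nI: "i \<in> I \<Longrightarrow> m i \<le> n" for i unfolding n_def I_def by (intro Max_ge) auto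
  have n1: "1 \<le> n" unfolding n_def I_def by (intro Max_ge) auto
  have less: "y - x \<le> \<epsilon>"
    if k: "k \<ge> n" and x: "\<bar>x\<bar> \<le> D" and y: "\<bar>y\<bar> \<le> D" and eq: "Q k x = Q k y" for k x y
  proof (rule ccontr)
    assume "\<not> y - x \<le> \<epsilon>"
    then have gap: "y > x + 2 * d" by (simp add: d_def)
    define i where "i = \<lceil>x / d\<rceil>"
    have i1: "x \<le> g i" "g i < x + d"
    proof -
      have "x / d \<le> real_of_int i" "real_of_int i < x / d + 1"
        using ceiling_correct[of "x / d"] by (auto simp: i_def)
      then show "x \<le> g i" "g i < x + d" using d by (simp_all add: g_def field_simps)
    qed
    have i2: "g (i + 1) \<le> y" "g i \<le> y" "x \<le> g (i + 1)"
      using i1 gap d by (auto simp: g_def algebra_simps)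
    have "- D / d \<le> x / d" "x / d \<le> D / d"
      using x d by (auto simp: divide_right_mono abs_le_iff field_simps)
    then have "\<lfloor>- D / d\<rfloor> \<le> \<lceil>x / d\<rceil>" "\<lceil>x / d\<rceil> \<le> \<lceil>D / d\<rceil>"
      by (linarith, intro ceiling_mono)
    then have "i \<in> I" unfolding I_def i_def by simp
    then have k1: "k \<ge> m i" using nI k by force
    have "1 \<le> k" using n1 k by simp
    note part = partition_P[OF this] and int = interval_P[OF this]
    have "x \<in> Q k x" "y \<in> Q k x" using quantizer_mem(2)[OF part] eq by metis+
    then have "g i \<in> Q k x" "g (i + 1) \<in> Q k x"
      using right_semiclosed_interval_convex[OF int[OF quantizer_mem(1)[OF part]]] i1 i2 by blast+
    then have "Q k (g i) = Q k (g (i + 1))"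
      using quantizer_eqI[OF part quantizer_mem(1)[OF part]] by metis
    with m(2)[OF k1] show False by simp
  qed
  have "\<bar>x - y\<bar> \<le> \<epsilon>"
    if "k \<ge> n" "\<bar>x\<bar> \<le> D" "\<bar>y\<bar> \<le> D" "Q k x = Q k y" for k x y
    using less[of k x y] less[of k y x] that by auto
  with n1 that show thesis by blast
qed

end

section \<open>Recurrence and the return map\<close>

lemma distr_funpow_self:
  assumes [measurable]: "T \<in> M \<rightarrow>\<^sub>M M" and "distr M M T = M"
  shows "distr M M (T ^^ n) = M"
proof (induction n)
  case 0
  then show ?case by (simp add: id_def)
next
  case (Suc n)
  have "distr M M (T ^^ Suc n) = distr (distr M M (T ^^ n)) M T"
    by (subst distr_distr) (auto simp: o_def)
  with Suc assms show ?case by (simp add: o_def)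
qed

lemma emeasure_vimage_self:
  assumes "T \<in> M \<rightarrow>\<^sub>M M" "distr M M T = M" "A \<in> sets M"
  shows "emeasure M (T -` A \<inter> space M) = emeasure M A"
  using emeasure_distr[OF assms(1,3)] assms(2) by simp

text \<open>
  Poincare recurrence. The points of \<open>B\<close> that never return form a wandering set: its preimages
  are disjoint and all have the same measure, which must be \<open>0\<close> when the total measure is finite.
\<close>

lemma (in finite_measure) poincare_recurrence:
  assumes T [measurable]: "T \<in> M \<rightarrow>\<^sub>M M" and inv: "distr M M T = M"
    and B [measurable]: "B \<in> sets M"
  shows "AE x in M. x \<in> B \<longrightarrow> (\<exists>t>0. (T ^^ t) x \<in> B)"
proof -
  define N where "N = {x \<in> space M. x \<in> B \<and> (\<forall>t>0. (T ^^ t) x \<notin> B)}"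
  have [measurable]: "N \<in> sets M" unfolding N_def by measurable
  define W where "W n = (T ^^ n) -` N \<inter> space M" for n
  have W_sets [measurable]: "W n \<in> sets M" for n unfolding W_def by measurable
  have "measure M (W n) = measure M N" for n
    using emeasure_vimage_self[of "T ^^ n" M N] distr_funpow_self[OF T inv, of n]
    by (simp add: W_def measure_def)
  moreover have "disjoint_family W"
    unfolding disjoint_family_on_def
  proof (intro ballI impI)
    fix m n :: nat assume "m \<noteq> n"
    have no: "W i \<inter> W j = {}" if "i < j" for i j
    proof -
      have "(T ^^ j) x = (T ^^ (j - i)) ((T ^^ i) x)" for x
        using that by (simp flip: funpow_add comp_apply[where f = "T ^^ (j - i)" and g = "T ^^ i"])
      then show ?thesis using that by (auto simp: W_def N_def)
    qed
    from \<open>m \<noteq> n\<close> show "W m \<inter> W n = {}"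
      using no[of m n] no[of n m] by (cases "m < n") auto
  qed
  then have "(\<lambda>n. measure M (W n)) sums measure M (\<Union>n. W n)"
    by (intro finite_measure_UNION) auto
  ultimately have "summable (\<lambda>n::nat. measure M N)"
    by (simp add: sums_iff)
  then have "measure M N = 0" by (simp add: summable_const_iff)
  then have "N \<in> null_sets M" by (simp add: emeasure_eq_measure null_setsI)
  then show ?thesis by (rule AE_I') (unfold N_def, blast)
qed

lemma (in finite_measure) poincare_recurrence_label:
  assumes T [measurable]: "T \<in> M \<rightarrow>\<^sub>M M" and inv: "distr M M T = M"
    and \<phi>: "\<phi> \<in> M \<rightarrow>\<^sub>M count_space K" and K: "countable K"
  shows "AE x in M. \<exists>t>0. \<phi> ((T ^^ t) x) = \<phi> x"
proof -
  have "AE x in M. \<forall>b\<in>K. x \<in> \<phi> -` {b} \<inter> space M \<longrightarrow> (\<exists>t>0. (T ^^ t) x \<in> \<phi> -` {b} \<inter> space M)"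
    unfolding AE_ball_countable[OF K]
    by (intro ballI poincare_recurrence[OF T inv] measurable_sets[OF \<phi>]) simp
  then show ?thesis
    using AE_space
  proof eventually_elim
    case (elim x)
    with measurable_space[OF \<phi>, of x] show ?case by auto
  qed
qed

lemma first_time_exists:
  assumes "\<exists>t>0. P (t::nat)"
  obtains t where "t > 0" "P t" "\<And>s. 0 < s \<Longrightarrow> s < t \<Longrightarrow> \<not> P s"
  using exists_least_iff[of "\<lambda>t. t > 0 \<and> P t"] assms by auto

text \<open>
  The map sending a point to its first return to its own cell preserves the measure. On the
  points whose return time under \<open>S\<close> is \<open>t\<close>, it is \<open>S\<^sup>t\<close>, and \<open>S\<^sup>t\<close> carries them exactly to the points
  whose return time under the inverse map \<open>T\<close> is \<open>t\<close>. Summing over \<open>t\<close> exhausts the space on both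
  sides, by recurrence.
\<close>

lemma (in finite_measure) distr_return_map:
  assumes S [measurable]: "S \<in> M \<rightarrow>\<^sub>M M" and S_inv: "distr M M S = M"
    and T [measurable]: "T \<in> M \<rightarrow>\<^sub>M M" and T_inv: "distr M M T = M"
    and TS: "\<And>x. x \<in> space M \<Longrightarrow> T (S x) = x" and ST: "\<And>x. x \<in> space M \<Longrightarrow> S (T x) = x"
    and \<phi> [measurable]: "\<phi> \<in> M \<rightarrow>\<^sub>M count_space K" and K: "countable K"
    and r [measurable]: "r \<in> M \<rightarrow>\<^sub>M count_space UNIV"
    and first: "AE x in M. 0 < r x \<and> \<phi> ((S ^^ r x) x) = \<phi> x \<and>
                  (\<forall>s. 0 < s \<and> s < r x \<longrightarrow> \<phi> ((S ^^ s) x) \<noteq> \<phi> x)"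
  shows "distr M M (\<lambda>x. (S ^^ r x) x) = M"
proof (rule measure_eqI)
  have Sn [measurable]: "S ^^ n \<in> M \<rightarrow>\<^sub>M M" and Tn [measurable]: "T ^^ n \<in> M \<rightarrow>\<^sub>M M" for n
    by measurable
  have Sr [measurable]: "(\<lambda>x. (S ^^ r x) x) \<in> M \<rightarrow>\<^sub>M M"
    by (rule measurable_compose_countable[where f = "\<lambda>n x. (S ^^ n) x" and g = r]) auto
  have SnTn: "(S ^^ n) ((T ^^ n) x) = x" if "x \<in> space M" for n x
    using that
  proof (induction n arbitrary: x)
    case (Suc n)
    then have "T x \<in> space M" using measurable_space[OF T] by blast
    with Suc ST show ?case by (simp add: funpow_swap1)
  qed auto
  have TnSn: "(T ^^ n) ((S ^^ n) x) = x" if "x \<in> space M" for n x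
    using that
  proof (induction n arbitrary: x)
    case (Suc n)
    then have "S x \<in> space M" using measurable_space[OF S] by blast
    with Suc TS show ?case by (simp add: funpow_swap1)
  qed auto
  have eqP [measurable]: "Measurable.pred M (\<lambda>x. \<phi> (f x) = \<phi> x)" if [measurable]: "f \<in> M \<rightarrow>\<^sub>M M" for f
  proof -
    have "{x \<in> space M. \<phi> (f x) = \<phi> x} = (\<Union>b\<in>K. {x \<in> space M. \<phi> (f x) = b \<and> \<phi> x = b})"
      using measurable_space[OF \<phi>] by auto
    also have "\<dots> \<in> sets M"
    proof (rule sets.countable_UN''[OF K])
      fix b assume "b \<in> K"
      then have "\<phi> -` {b} \<inter> space M \<in> sets M" by (intro measurable_sets[OF \<phi>]) auto
      then have "(\<phi> -` {b} \<inter> space M) \<inter> (f -` (\<phi> -` {b} \<inter> space M) \<inter> space M) \<in> sets M"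
        by measurable
      then show "{x \<in> space M. \<phi> (f x) = b \<and> \<phi> x = b} \<in> sets M"
        by (rule back_subst[of "\<lambda>A. A \<in> sets M"]) (auto dest: measurable_space[OF that])
    qed
    finally show ?thesis by (simp add: pred_def)
  qed
  fix C assume "C \<in> sets (distr M M (\<lambda>x. (S ^^ r x) x))"
  then have C [measurable]: "C \<in> sets M" by simp
  define first_at where "first_at R t x \<longleftrightarrow>
    0 < t \<and> \<phi> ((R ^^ t) x) = \<phi> x \<and> (\<forall>s. 0 < s \<and> s < t \<longrightarrow> \<phi> ((R ^^ s) x) \<noteq> \<phi> x)" for R t x
  have first_at_unique: "s = t" if "first_at R s x" "first_at R t x" for R s t x
    using that unfolding first_at_def by (metis linorder_neqE_nat)
  define A where "A t = {x \<in> space M. first_at S t x \<and> (S ^^ t) x \<in> C}" for t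
  define B where "B t = {x \<in> space M. first_at T t x \<and> x \<in> C}" for t
  have A_sets [measurable]: "A t \<in> sets M" and B_sets [measurable]: "B t \<in> sets M" for t
    unfolding A_def B_def first_at_def by measurable
  have AB: "A t = (S ^^ t) -` B t \<inter> space M" for t
  proof -
    have "first_at S t x \<longleftrightarrow> first_at T t ((S ^^ t) x)" if x: "x \<in> space M" for x
    proof -
      have eq: "(T ^^ s) ((S ^^ t) x) = (S ^^ (t - s)) x" if "s \<le> t" for s
      proof -
        have "(S ^^ t) x = (S ^^ s) ((S ^^ (t - s)) x)"
          using that by (metis add_diff_inverse_nat comp_apply funpow_add not_less)
        then show ?thesis using TnSn measurable_space[OF Sn x] by simp
      qed
      have "(\<forall>s. 0 < s \<and> s < t \<longrightarrow> \<phi> ((S ^^ s) x) \<noteq> \<phi> x) \<longleftrightarrow>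
            (\<forall>s. 0 < s \<and> s < t \<longrightarrow> \<phi> ((S ^^ (t - s)) x) \<noteq> \<phi> x)"
        by (metis diff_diff_cancel diff_less less_imp_le zero_less_diff less_le_trans)
      then show ?thesis
        unfolding first_at_def using eq TnSn[OF x, of t] by (auto simp: eq)
    qed
    then show ?thesis by (auto simp: A_def B_def measurable_space[OF Sn])
  qed
  have union: "emeasure M E = (\<Sum>t. emeasure M {x \<in> space M. first_at R t x \<and> x \<in> E})"
    if R [measurable]: "R \<in> M \<rightarrow>\<^sub>M M" and R_inv: "distr M M R = M" and E [measurable]: "E \<in> sets M" for R E
  proof -
    let ?E = "\<lambda>t. {x \<in> space M. first_at R t x \<and> x \<in> E}"
    have meas: "?E t \<in> sets M" for t unfolding first_at_def by measurable
    have "AE x in M. x \<in> E \<longleftrightarrow> x \<in> (\<Union>t. ?E t)"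
      using poincare_recurrence_label[OF R R_inv \<phi> K] AE_space
    proof eventually_elim
      case (elim x)
      then obtain t where "first_at R t x"
        using first_time_exists[of "\<lambda>t. \<phi> ((R ^^ t) x) = \<phi> x"] unfolding first_at_def by metis
      with elim(2) show ?case by auto
    qed
    then have "emeasure M E = emeasure M (\<Union>t. ?E t)"
      by (rule emeasure_eq_AE) (use meas in auto)
    also have "\<dots> = (\<Sum>t. emeasure M (?E t))"
      using meas first_at_unique
      by (intro suminf_emeasure[symmetric]) (auto simp: disjoint_family_on_def)
    finally show ?thesis .
  qed
  have "emeasure (distr M M (\<lambda>x. (S ^^ r x) x)) C = emeasure M ((\<lambda>x. (S ^^ r x) x) -` C \<inter> space M)"
    by (rule emeasure_distr) auto
  also have "\<dots> = (\<Sum>t. emeasure M {x \<in> space M. first_at S t x \<and> x \<in> (\<lambda>x. (S ^^ r x) x) -` C \<inter> space M})"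
    by (rule union[OF S S_inv]) measurable
  also have "\<dots> = (\<Sum>t. emeasure M (A t))"
  proof (rule suminf_cong, rule emeasure_eq_AE)
    fix t
    show "AE x in M. x \<in> {x \<in> space M. first_at S t x \<and> x \<in> (\<lambda>x. (S ^^ r x) x) -` C \<inter> space M} \<longleftrightarrow> x \<in> A t"
      using first
    proof eventually_elim
      case (elim x)
      then have "first_at S (r x) x" by (simp add: first_at_def)
      then show ?case using first_at_unique[of S t x "r x"] by (auto simp: A_def)
    qed
    show "{x \<in> space M. first_at S t x \<and> x \<in> (\<lambda>x. (S ^^ r x) x) -` C \<inter> space M} \<in> sets M"
      unfolding first_at_def by measurable
  qed auto
  also have "\<dots> = (\<Sum>t. emeasure M (B t))"
    unfolding AB by (intro suminf_cong emeasure_vimage_self distr_funpow_self) (auto simp: S_inv)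
  also have "\<dots> = emeasure M C"
    unfolding B_def by (rule union[OF T T_inv, symmetric]) auto
  finally show "emeasure (distr M M (\<lambda>x. (S ^^ r x) x)) C = emeasure M C" .
qed simp

section \<open>Events that respect a relation, a strong law and a maximal inequality\<close>

text \<open>
  The information available at a random stage is encoded by which paths it cannot tell apart: its
  events are those that never separate two \<open>R\<close>-related points. With this encoding, inclusions
  and measurability reduce to statements about single pairs of points; \<open>R\<close> may be any relation,
  since the condition on an event is symmetric and transitive by itself.
\<close>

definition inv_algebra :: "'a measure \<Rightarrow> ('a \<Rightarrow> 'a \<Rightarrow> bool) \<Rightarrow> 'a measure" where
  "inv_algebra M R =
     sigma (space M) {A \<in> sets M. \<forall>x\<in>space M. \<forall>y\<in>space M. R x y \<longrightarrow> (x \<in> A \<longleftrightarrow> y \<in> A)}"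

lemma space_inv_algebra [simp]: "space (inv_algebra M R) = space M"
  unfolding inv_algebra_def by (rule space_measure_of) (auto dest: sets.sets_into_space)

lemma sets_inv_algebra:
  "sets (inv_algebra M R) =
     {A \<in> sets M. \<forall>x\<in>space M. \<forall>y\<in>space M. R x y \<longrightarrow> (x \<in> A \<longleftrightarrow> y \<in> A)}" (is "_ = ?\<A>")
proof -
  have "sigma_algebra (space M) ?\<A>"
    unfolding sigma_algebra_iff2
  proof (intro conjI ballI allI impI)
    show "?\<A> \<subseteq> Pow (space M)" by (auto dest: sets.sets_into_space)
    show "{} \<in> ?\<A>" by simp
    fix A assume "A \<in> ?\<A>"
    then show "space M - A \<in> ?\<A>" by auto
  next
    fix A :: "nat \<Rightarrow> 'a set" assume "range A \<subseteq> ?\<A>"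
    then have A: "A n \<in> sets M" "\<forall>x\<in>space M. \<forall>y\<in>space M. R x y \<longrightarrow> (x \<in> A n \<longleftrightarrow> y \<in> A n)" for n
      by auto
    from A(1) have "(\<Union>n. A n) \<in> sets M" by auto
    with A(2) show "\<Union> (range A) \<in> ?\<A>" by blast
  qed
  then show ?thesis unfolding inv_algebra_def by (rule sigma_algebra.sets_measure_of_eq)
qed

lemma subalgebra_inv_algebra: "subalgebra M (inv_algebra M R)"
  by (auto simp: subalgebra_def sets_inv_algebra)

lemma subalgebra_inv_algebra_mono:
  assumes "\<And>x y. R' x y \<Longrightarrow> R x y"
  shows "subalgebra (inv_algebra M R') (inv_algebra M R)"
  using assms by (auto simp: subalgebra_def sets_inv_algebra)

lemma measurable_inv_algebra:
  assumes f: "f \<in> M \<rightarrow>\<^sub>M N"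
    and inv: "\<And>x y. x \<in> space M \<Longrightarrow> y \<in> space M \<Longrightarrow> R x y \<Longrightarrow> f x = f y"
  shows "f \<in> inv_algebra M R \<rightarrow>\<^sub>M N"
proof (rule measurableI)
  fix A assume "A \<in> sets N"
  with measurable_sets[OF f this] show "f -` A \<inter> space (inv_algebra M R) \<in> sets (inv_algebra M R)"
    by (auto simp: sets_inv_algebra dest: inv)
qed (use measurable_space[OF f] in auto)

context prob_space
begin

lemma cond_exp_subalgebra: "subalgebra M F \<Longrightarrow> sigma_finite_subalgebra M F"
  by (intro finite_measure_subalgebra_is_sigma_finite)
     (simp add: finite_measure_subalgebra_def finite_measure_subalgebra_axioms_def finite_measure_axioms)

lemma cond_exp_bounded:
  assumes sub: "subalgebra M F" and [measurable]: "f \<in> borel_measurable M"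
    and bd: "AE x in M. \<bar>f x\<bar> \<le> c"
  shows "AE x in M. \<bar>real_cond_exp M F f x\<bar> \<le> c"
proof -
  interpret F: sigma_finite_subalgebra M F by (rule cond_exp_subalgebra[OF sub])
  have int: "integrable M f" by (rule integrable_const_bound[where B = c]) (use bd in auto)
  have "AE x in M. real_cond_exp M F f x \<le> c"
    by (rule F.real_cond_exp_le_c[OF int]) (use bd in auto)
  moreover have "AE x in M. real_cond_exp M F f x \<ge> - c"
    by (rule F.real_cond_exp_ge_c[OF int]) (use bd in \<open>auto simp: abs_le_iff\<close>)
  ultimately show ?thesis by eventually_elim auto
qed

lemma cond_exp_abs_le:
  assumes sub: "subalgebra M F" and f: "integrable M f"
  shows "AE x in M. \<bar>real_cond_exp M F f x\<bar> \<le> real_cond_exp M F (\<lambda>x. \<bar>f x\<bar>) x"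
proof -
  interpret F: sigma_finite_subalgebra M F by (rule cond_exp_subalgebra[OF sub])
  note [measurable] = borel_measurable_integrable[OF f]
  have "AE x in M. real_cond_exp M F f x \<le> real_cond_exp M F (\<lambda>x. \<bar>f x\<bar>) x"
    by (rule F.real_cond_exp_mono) (use f in auto)
  moreover have "AE x in M. real_cond_exp M F (\<lambda>x. - 1 * f x) x \<le> real_cond_exp M F (\<lambda>x. \<bar>f x\<bar>) x"
    by (rule F.real_cond_exp_mono) (use f in auto)
  moreover have "AE x in M. real_cond_exp M F (\<lambda>x. - 1 * f x) x = - 1 * real_cond_exp M F f x"
    by (rule F.real_cond_exp_cmult[OF f])
  ultimately show ?thesis by eventually_elim auto
qed

text \<open>
  A strong law for bounded orthogonal variables. Orthogonality gives \<open>E S\<^sub>n\<^sup>2 \<le> n c\<^sup>2\<close>, so the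
  averages converge along the squares by summability of \<open>1/n\<^sup>2\<close>, and boundedness
  bridges the gaps \<open>(n + 1)\<^sup>2 - n\<^sup>2 = O(n)\<close> between squares.
\<close>

lemma strong_law_orthogonal:
  fixes Y :: "nat \<Rightarrow> 'a \<Rightarrow> real"
  assumes Y [measurable]: "\<And>n. Y n \<in> borel_measurable M"
    and bd: "\<And>n. AE x in M. \<bar>Y n x\<bar> \<le> c"
    and orth: "\<And>i j. i < j \<Longrightarrow> expectation (\<lambda>x. Y i x * Y j x) = 0"
  shows "AE x in M. (\<lambda>k. (\<Sum>j<k. Y j x) / real k) \<longlonglongrightarrow> 0"
proof -
  define S where "S n x = (\<Sum>j<n. Y j x)" for n x
  have [measurable]: "S n \<in> borel_measurable M" for n unfolding S_def by measurable
  have bd': "AE x in M. \<forall>n. \<bar>Y n x\<bar> \<le> c" using bd by (simp add: AE_all_countable)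
  have diff_le: "\<bar>S m x - S n x\<bar> \<le> real (m - n) * c" if "n \<le> m" "\<forall>n. \<bar>Y n x\<bar> \<le> c" for m n x
  proof -
    have "S m x - S n x = (\<Sum>j\<in>{n..<m}. Y j x)"
      using that(1) by (simp add: S_def sum_diff_nat_ivl lessThan_atLeast0)
    also have "\<bar>\<dots>\<bar> \<le> (\<Sum>j\<in>{n..<m}. c)"
      by (rule order_trans[OF sum_abs sum_mono]) (use that in auto)
    finally show ?thesis by simp
  qed
  have S_bd: "AE x in M. \<bar>S n x\<bar> \<le> real n * c" for n
    using bd' by eventually_elim (use diff_le[of 0 n] in \<open>simp add: S_def\<close>)
  have YY: "integrable M (\<lambda>x. Y i x * Y j x)" for i j
  proof (rule integrable_const_bound[where B = "c * c"])
    show "AE x in M. norm (Y i x * Y j x) \<le> c * c"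
      using bd' by eventually_elim (simp add: abs_mult mult_mono')
  qed measurable
  have SY: "integrable M (\<lambda>x. S n x * Y n x)" for n
    unfolding S_def sum_distrib_right by (intro Bochner_Integration.integrable_sum YY)
  have SY_0: "expectation (\<lambda>x. S n x * Y n x) = 0" for n
    unfolding S_def sum_distrib_right by (subst Bochner_Integration.integral_sum) (auto intro: YY simp: orth)
  have "integrable M (\<lambda>x. (S n x)\<^sup>2) \<and> expectation (\<lambda>x. (S n x)\<^sup>2) \<le> real n * c\<^sup>2" for n
  proof (induction n)
    case (Suc n)
    have eq: "(S (Suc n) x)\<^sup>2 = (S n x)\<^sup>2 + 2 * (S n x * Y n x) + Y n x * Y n x" for x
      by (simp add: S_def power2_eq_square algebra_simps)
    have "expectation (\<lambda>x. Y n x * Y n x) \<le> expectation (\<lambda>x. c\<^sup>2)"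
    proof (rule integral_mono_AE[OF YY])
      show "AE x in M. Y n x * Y n x \<le> c\<^sup>2"
        using bd'
      proof eventually_elim
        case (elim x)
        then have "\<bar>Y n x\<bar>\<^sup>2 \<le> c\<^sup>2" by (intro power_mono) auto
        then show ?case by (simp add: power2_eq_square)
      qed
    qed simp
    with Suc SY YY show ?case
      unfolding eq by (simp add: SY_0 prob_space algebra_simps)
  qed (simp add: S_def)
  note sq = conjunct1[OF this] conjunct2[OF this]
  define V where "V n x = (S ((Suc n)\<^sup>2) x / real ((Suc n)\<^sup>2))\<^sup>2" for n x
  have V_int: "integrable M (V n)" for n
    unfolding V_def power_divide by (intro Bochner_Integration.integrable_divide sq)
  have V_le: "expectation (V n) \<le> c\<^sup>2 / (real (Suc n))\<^sup>2" for n
  proof -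
    have "expectation (V n) = expectation (\<lambda>x. (S ((Suc n)\<^sup>2) x)\<^sup>2) / (real ((Suc n)\<^sup>2))\<^sup>2"
      unfolding V_def power_divide by simp
    also have "\<dots> \<le> (real ((Suc n)\<^sup>2) * c\<^sup>2) / (real ((Suc n)\<^sup>2))\<^sup>2"
      by (intro divide_right_mono sq) simp
    also have "\<dots> = c\<^sup>2 / (real (Suc n))\<^sup>2"
      unfolding of_nat_power by (simp add: power2_eq_square del: of_nat_Suc)
    finally show ?thesis .
  qed
  have summ: "summable (\<lambda>n. c\<^sup>2 / (real (Suc n))\<^sup>2)"
    using summable_mult[OF summable_ignore_initial_segment[OF inverse_power_summable[of 2, where 'a = real], of 1], of "c\<^sup>2"]
    by (simp add: field_simps)
  have "(\<integral>\<^sup>+x. (\<Sum>n. ennreal (V n x)) \<partial>M) = (\<Sum>n. \<integral>\<^sup>+x. ennreal (V n x) \<partial>M)"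
    by (rule nn_integral_suminf) (auto simp: V_def)
  also have "\<dots> = (\<Sum>n. ennreal (expectation (V n)))"
    by (intro suminf_cong nn_integral_eq_integral V_int) (auto simp: V_def)
  also have "\<dots> \<le> (\<Sum>n. ennreal (c\<^sup>2 / (real (Suc n))\<^sup>2))"
    by (intro suminf_le ennreal_leI V_le) auto
  also have "\<dots> = ennreal (\<Sum>n. c\<^sup>2 / (real (Suc n))\<^sup>2)"
    by (rule suminf_ennreal2[OF _ summ]) simp
  also have "\<dots> < \<infinity>" by simp
  finally have "AE x in M. (\<Sum>n. ennreal (V n x)) \<noteq> \<infinity>"
    by (intro nn_integral_noteq_infinite) (auto simp: V_def)
  then show ?thesis using bd'
  proof eventually_elim
    case (elim x)
    then have c: "c \<ge> 0" using order_trans[OF abs_ge_zero] by blast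
    have "summable (\<lambda>n. V n x)"
      using elim(1) by (intro summable_suminf_not_top) (auto simp: V_def)
    then have "(\<lambda>n. sqrt (V n x)) \<longlonglongrightarrow> sqrt 0"
      by (intro tendsto_real_sqrt summable_LIMSEQ_zero)
    then have sqr: "(\<lambda>n. \<bar>S ((Suc n)\<^sup>2) x / real ((Suc n)\<^sup>2)\<bar>) \<longlonglongrightarrow> 0"
      by (simp add: V_def)
    \<comment> \<open>\<open>V\<close> starts at \<open>n = 1\<close> to avoid division by \<open>0\<close>, so the square below \<open>k\<close> has index \<open>\<lfloor>\<surd>k\<rfloor> - 1\<close>.\<close>
    define r where "r k = floor_sqrt k - 1" for k
    have r: "filterlim r at_top sequentially"
      unfolding filterlim_at_top
    proof
      fix Z
      show "\<forall>\<^sub>F k in sequentially. Z \<le> r k"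
        using eventually_ge_at_top[of "(Suc Z)\<^sup>2"]
      proof eventually_elim
        case (elim k)
        then have "Suc Z \<le> floor_sqrt k" by (simp add: le_floor_sqrt_iff)
        then show ?case by (simp add: r_def)
      qed
    qed
    have "(\<lambda>k. \<bar>S ((Suc (r k))\<^sup>2) x / real ((Suc (r k))\<^sup>2)\<bar> + 2 * c / real (Suc (r k))) \<longlonglongrightarrow> 0 + 0"
      by (intro tendsto_add filterlim_compose[OF sqr r]
          filterlim_compose[OF _ r, of "\<lambda>n. 2 * c / real (Suc n)"] LIMSEQ_Suc lim_const_over_n)
    then have lim: "(\<lambda>k. \<bar>S ((Suc (r k))\<^sup>2) x / real ((Suc (r k))\<^sup>2)\<bar> + 2 * c / real (Suc (r k))) \<longlonglongrightarrow> 0"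
      by simp
    show "(\<lambda>k. (\<Sum>j<k. Y j x) / real k) \<longlonglongrightarrow> 0"
    proof (rule Lim_null_comparison[OF _ lim])
      show "\<forall>\<^sub>F k in sequentially. norm ((\<Sum>j<k. Y j x) / real k)
              \<le> \<bar>S ((Suc (r k))\<^sup>2) x / real ((Suc (r k))\<^sup>2)\<bar> + 2 * c / real (Suc (r k))"
        using eventually_ge_at_top[of 1]
      proof eventually_elim
        case (elim k)
        define n where "n = Suc (r k)"
        have "floor_sqrt k > 0" using elim by simp
        then have n: "n = floor_sqrt k" by (simp add: n_def r_def)
        have n0: "n > 0" by (simp add: n_def)
        have nk: "n\<^sup>2 \<le> k" unfolding n by simp
        have kn: "k < (Suc n)\<^sup>2" unfolding n by (rule Suc_floor_sqrt_power2_gt)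
        have "k - n\<^sup>2 \<le> 2 * n" using kn by (simp add: power2_eq_square)
        then have "real (k - n\<^sup>2) * c \<le> real (2 * n) * c"
          using c by (intro mult_right_mono) auto
        then have "\<bar>S k x\<bar> \<le> \<bar>S (n\<^sup>2) x\<bar> + 2 * real n * c"
          using diff_le[OF nk] \<open>\<forall>n. \<bar>Y n x\<bar> \<le> c\<close> by force
        then have "\<bar>S k x\<bar> / real k \<le> (\<bar>S (n\<^sup>2) x\<bar> + 2 * real n * c) / real k"
          by (intro divide_right_mono) auto
        also have "\<dots> \<le> (\<bar>S (n\<^sup>2) x\<bar> + 2 * real n * c) / real (n\<^sup>2)"
          using nk n0 c elim by (intro divide_left_mono mult_pos_pos) (auto simp flip: of_nat_power)
        also have "\<dots> = \<bar>S (n\<^sup>2) x / real (n\<^sup>2)\<bar> + 2 * c / real n"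
          using n0 by (simp add: add_divide_distrib power2_eq_square)
        finally show ?case unfolding n_def by (simp add: S_def)
      qed
    qed
  qed
qed

text \<open>
  Doob's maximal inequality: on the event that \<open>n\<close> is the first index with \<open>E(W | F n) > \<epsilon>\<close>,
  which lies in \<open>F n\<close>, the integral of \<open>W\<close> is at least \<open>\<epsilon>\<close> times the probability.
\<close>

lemma cond_exp_maximal_inequality:
  fixes F :: "nat \<Rightarrow> 'a measure"
  assumes sub: "\<And>n. subalgebra M (F n)"
    and mono: "\<And>m n. m \<le> n \<Longrightarrow> subalgebra (F n) (F m)"
    and W: "integrable M W" "\<And>x. W x \<ge> 0" and \<epsilon>: "\<epsilon> > 0"
  shows "prob {x \<in> space M. \<exists>n. \<epsilon> < real_cond_exp M (F n) W x} \<le> expectation W / \<epsilon>"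
proof -
  define C where "C n = real_cond_exp M (F n) W" for n
  define A where "A n = {x \<in> space M. \<epsilon> < C n x \<and> (\<forall>m<n. \<not> \<epsilon> < C m x)}" for n
  have C_meas [measurable]: "C m \<in> borel_measurable (F n)" if "m \<le> n" for m n
    unfolding C_def by (rule measurable_from_subalg[OF mono[OF that]]) simp
  have A_F: "A n \<in> sets (F n)" for n
  proof -
    have "space M = space (F n)" using sub[of n] by (simp add: subalgebra_def)
    moreover have "Measurable.pred (F n) (\<lambda>x. \<forall>m\<in>{..<n}. \<not> \<epsilon> < C m x)"
      by (rule pred_intros_finite) (auto intro!: borel_measurable_pred_less C_meas)
    moreover have "Measurable.pred (F n) (\<lambda>x. \<epsilon> < C n x)" by measurable
    ultimately show ?thesis unfolding A_def by (auto simp: pred_def Ball_def intro!: sets.sets_Collect_conj)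
  qed
  then have A [measurable]: "A n \<in> sets M" for n using sub[of n] by (auto simp: subalgebra_def)
  have disj: "disjoint_family A"
    unfolding disjoint_family_on_def A_def by (auto simp: neq_iff)
  have ind_W: "integrable M (\<lambda>x. indicator (A n) x * W x)" for n
    using integrable_mult_indicator[OF A W(1)] by simp
  have le: "\<epsilon> * prob (A n) \<le> expectation (\<lambda>x. indicator (A n) x * W x)" for n
  proof -
    interpret F: sigma_finite_subalgebra M "F n" by (rule cond_exp_subalgebra[OF sub])
    have int: "integrable M (\<lambda>x. indicator (A n) x * C n x)"
      using integrable_mult_indicator[OF A F.real_cond_exp_int(1)[OF W(1)]] by (simp add: C_def)
    have "\<epsilon> * prob (A n) = expectation (\<lambda>x. indicator (A n) x * \<epsilon>)"
      by (simp add: mult.commute)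
    also have "\<dots> \<le> expectation (\<lambda>x. indicator (A n) x * C n x)"
    proof (rule integral_mono[OF _ int])
      show "indicator (A n) x * \<epsilon> \<le> indicator (A n) x * C n x" for x
        by (auto simp: A_def split: split_indicator)
    qed (auto intro!: integrable_mult_left integrable_real_indicator simp: less_top[symmetric])
    also have "\<dots> = expectation (\<lambda>x. indicator (A n) x * W x)"
      unfolding C_def using A_F W(1) ind_W by (intro F.real_cond_exp_intg) auto
    finally show ?thesis .
  qed
  have "(\<Sum>n<N. prob (A n)) \<le> expectation W / \<epsilon>" for N
  proof -
    have "\<epsilon> * (\<Sum>n<N. prob (A n)) \<le> (\<Sum>n<N. expectation (\<lambda>x. indicator (A n) x * W x))"
      unfolding sum_distrib_left by (intro sum_mono le)
    also have "\<dots> = expectation (\<lambda>x. \<Sum>n<N. indicator (A n) x * W x)"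
      by (rule Bochner_Integration.integral_sum[symmetric]) (rule ind_W)
    also have "\<dots> \<le> expectation W"
    proof (rule integral_mono)
      fix x
      have "(\<Sum>n<N. indicator (A n) x) = (indicator (\<Union>n<N. A n) x :: real)"
        using disj by (intro indicator_UN_disjoint[symmetric]) (auto simp: disjoint_family_on_def)
      then have "(\<Sum>n<N. indicator (A n) x * W x) = indicator (\<Union>n<N. A n) x * W x"
        by (simp flip: sum_distrib_right)
      also have "\<dots> \<le> W x" using W(2)[of x] by (simp add: indicator_def)
      finally show "(\<Sum>n<N. indicator (A n) x * W x) \<le> W x" .
    qed (intro Bochner_Integration.integrable_sum ind_W, rule W)
    finally show ?thesis using \<epsilon> by (simp add: field_simps)
  qed
  moreover have sums: "(\<lambda>n. prob (A n)) sums prob (\<Union>n. A n)"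
    using disj by (intro finite_measure_UNION) auto
  ultimately have "prob (\<Union>n. A n) \<le> expectation W / \<epsilon>"
    unfolding sums_unique[OF sums] by (intro suminf_le_const sums_summable[OF sums])
  moreover have "{x \<in> space M. \<exists>n. \<epsilon> < C n x} = (\<Union>n. A n)"
    unfolding A_def using exists_least_iff[of "\<lambda>n. \<epsilon> < C n _"] by auto
  ultimately show ?thesis by (simp add: C_def)
qed

end

section \<open>Levy's upward theorem\<close>

context prob_space
begin

text \<open>
  The events that can be approximated are closed under complements and countable unions (a countable
  union is close to a finite one), and the generators are approximated by themselves.
\<close>

lemma filtration_approximates_set:
  fixes F :: "nat \<Rightarrow> 'a measure"
  assumes sub: "\<And>n. subalgebra M (F n)"
    and mono: "\<And>m n. m \<le> n \<Longrightarrow> subalgebra (F n) (F m)"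
    and "A \<in> sigma_sets (space M) (\<Union>n. sets (F n))" and "\<delta> > 0"
  obtains n B where "B \<in> sets (F n)" "prob (A - B \<union> (B - A)) \<le> \<delta>"
proof -
  have F_sets: "B \<in> sets M" if "B \<in> sets (F n)" for B n
    using sub[of n] that by (auto simp: subalgebra_def)
  have F_mono: "B \<in> sets (F n)" if "B \<in> sets (F m)" "m \<le> n" for B m n
    using mono[OF that(2)] that(1) by (auto simp: subalgebra_def)
  have sigma_M: "B \<in> sets M" if "B \<in> sigma_sets (space M) (\<Union>n. sets (F n))" for B
    using that sets.sigma_sets_subset[of "\<Union>n. sets (F n)" M] F_sets by blast
  have "\<exists>n. \<exists>B\<in>sets (F n). prob (A - B \<union> (B - A)) \<le> \<delta>"
    using assms(3,4)
  proof (induction arbitrary: \<delta>)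
    case (Basic A)
    then obtain n where "A \<in> sets (F n)" by blast
    with Basic show ?case by (intro exI[of _ n] bexI[of _ A]) auto
  next
    case Empty
    then show ?case by (intro exI[of _ 0] bexI[of _ "{}"]) auto
  next
    case (Compl A)
    then obtain n B where B: "B \<in> sets (F n)" "prob (A - B \<union> (B - A)) \<le> \<delta>" by blast
    have "space M - B \<in> sets (F n)" using B(1) sub[of n] by (metis sets.compl_sets subalgebra_def)
    moreover have "(space M - A) - (space M - B) \<union> ((space M - B) - (space M - A)) = A - B \<union> (B - A)"
      using sets.sets_into_space[OF F_sets[OF B(1)]] sets.sets_into_space[OF sigma_M[OF Compl.hyps]] by blast
    ultimately show ?case using B(2) by (intro exI[of _ n] bexI[of _ "space M - B"]) auto
  next
    case (Union A)
    have A [measurable]: "A i \<in> sets M" for i using sigma_M Union.hyps by blast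
    \<comment> \<open>Half of \<open>\<delta>\<close> is spent on cutting the union off at \<open>N\<close>, half on approximating \<open>N\<close> sets.\<close>
    have "(\<lambda>N. prob (\<Union>i<N. A i)) \<longlonglongrightarrow> prob (\<Union>N. \<Union>i<N. A i)"
      by (rule finite_Lim_measure_incseq) (auto simp: incseq_def intro: UN_mono[THEN subsetD] less_le_trans)
    moreover have "(\<Union>N. \<Union>i<N. A i) = (\<Union>i. A i)" by auto
    ultimately have "(\<lambda>N. prob (\<Union>i<N. A i)) \<longlonglongrightarrow> prob (\<Union>i. A i)" by simp
    then have "\<forall>\<^sub>F N in sequentially. prob (\<Union>i. A i) - \<delta> / 2 < prob (\<Union>i<N. A i)"
      by (rule order_tendstoD) (use Union.prems in simp)
    then obtain N where N: "prob (\<Union>i. A i) - \<delta> / 2 < prob (\<Union>i<N. A i)"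
      by (auto simp: eventually_sequentially)
    define \<eta> where "\<eta> = \<delta> / (2 * real (Suc N))"
    have \<eta>: "\<eta> > 0" "real N * \<eta> \<le> \<delta> / 2" using Union.prems by (auto simp: \<eta>_def field_simps)
    have "\<exists>n. \<exists>B\<in>sets (F n). prob (A i - B \<union> (B - A i)) \<le> \<eta>" for i
      using Union.IH \<eta>(1) by blast
    then obtain n B where B: "\<And>i. B i \<in> sets (F (n i))"
      "\<And>i. prob (A i - B i \<union> (B i - A i)) \<le> \<eta>" by metis
    have [measurable]: "B i \<in> sets M" for i using F_sets[OF B(1)] .
    define m where "m = Max (n ` {..<N})"
    have "n i \<le> m" if "i < N" for i using that unfolding m_def by (intro Max_ge) auto
    then have "(\<Union>i<N. B i) \<in> sets (F m)" using F_mono[OF B(1)] by auto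
    moreover have "prob ((\<Union>i. A i) - (\<Union>i<N. B i) \<union> ((\<Union>i<N. B i) - (\<Union>i. A i))) \<le> \<delta>"
    proof -
      have "prob ((\<Union>i. A i) - (\<Union>i<N. B i) \<union> ((\<Union>i<N. B i) - (\<Union>i. A i)))
          \<le> prob (((\<Union>i. A i) - (\<Union>i<N. A i)) \<union> (\<Union>i<N. A i - B i \<union> (B i - A i)))"
        by (rule finite_measure_mono) auto
      also have "\<dots> \<le> prob ((\<Union>i. A i) - (\<Union>i<N. A i)) + prob (\<Union>i<N. A i - B i \<union> (B i - A i))"
        by (rule measure_Un_le) auto
      also have "prob ((\<Union>i. A i) - (\<Union>i<N. A i)) = prob (\<Union>i. A i) - prob (\<Union>i<N. A i)"
        by (rule finite_measure_Diff) auto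
      also have "prob (\<Union>i<N. A i - B i \<union> (B i - A i)) \<le> (\<Sum>i<N. prob (A i - B i \<union> (B i - A i)))"
        by (rule finite_measure_subadditive_finite) auto
      also have "\<dots> \<le> (\<Sum>i<N. \<eta>)" by (intro sum_mono B)
      finally show ?thesis using N \<eta>(2) by simp
    qed
    ultimately show ?case by blast
  qed
  with that show thesis by blast
qed

text \<open>The passage from events to functions: sums, then \<open>L\<^sup>1\<close> limits of dominated simple functions.\<close>

lemma filtration_approximates_function:
  fixes F :: "nat \<Rightarrow> 'a measure" and Z :: "'a \<Rightarrow> real"
  assumes sub: "\<And>n. subalgebra M (F n)"
    and mono: "\<And>m n. m \<le> n \<Longrightarrow> subalgebra (F n) (F m)"
    and G: "subalgebra M G" "sets G \<subseteq> sigma_sets (space M) (\<Union>n. sets (F n))"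
    and Z: "integrable M Z" "Z \<in> borel_measurable G" and "\<delta> > 0"
  obtains n Z' where "Z' \<in> borel_measurable (F n)" "integrable M Z'"
    "expectation (\<lambda>x. \<bar>Z x - Z' x\<bar>) \<le> \<delta>"
proof -
  let ?G = "restr_to_subalg M G"
  have int_M: "integrable M f" if "integrable ?G f" for f :: "'a \<Rightarrow> real"
    using integrable_from_subalg[OF G(1) that] .
  have "integrable ?G Z" by (rule integrable_in_subalg[OF G(1) Z(2,1)])
  then have "\<forall>\<delta>>0. \<exists>n. \<exists>Z'\<in>borel_measurable (F n). integrable M Z' \<and> expectation (\<lambda>x. \<bar>Z x - Z' x\<bar>) \<le> \<delta>"
  proof (induction rule: integrable_induct)
    case (base A c)
    then have AG: "A \<in> sets G" by (simp add: sets_restr_to_subalg[OF G(1)])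
    show ?case
    proof (intro allI impI)
      fix \<delta> :: real assume "\<delta> > 0"
      then have "\<delta> / (\<bar>c\<bar> + 1) > 0" by (simp add: add_nonneg_pos)
      moreover have "A \<in> sigma_sets (space M) (\<Union>n. sets (F n))" using G(2) AG by blast
      ultimately obtain n B where B: "B \<in> sets (F n)" "prob (A - B \<union> (B - A)) \<le> \<delta> / (\<bar>c\<bar> + 1)"
        using filtration_approximates_set[of F A, OF sub mono] by metis
      have [measurable]: "A \<in> sets M" "B \<in> sets M"
        using AG G(1) B(1) sub[of n] by (auto simp: subalgebra_def)
      have "expectation (\<lambda>x. \<bar>indicator A x *\<^sub>R c - indicator B x * c\<bar>)
          = expectation (\<lambda>x. \<bar>c\<bar> * indicator (A - B \<union> (B - A)) x)"
        by (intro Bochner_Integration.integral_cong) (auto simp: indicator_def)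
      also have "\<dots> = \<bar>c\<bar> * prob (A - B \<union> (B - A))" by simp
      also have "\<dots> \<le> \<bar>c\<bar> * (\<delta> / (\<bar>c\<bar> + 1))" by (intro mult_left_mono B) simp
      also have "\<dots> \<le> \<delta>" using \<open>\<delta> > 0\<close> by (simp add: field_simps add_nonneg_pos)
      finally have "expectation (\<lambda>x. \<bar>indicator A x *\<^sub>R c - indicator B x * c\<bar>) \<le> \<delta>" .
      moreover have "(\<lambda>x. indicator B x * c) \<in> borel_measurable (F n)" using B(1) by measurable
      moreover have "integrable M (\<lambda>x. indicator B x * c)"
        by (auto intro!: integrable_mult_left integrable_real_indicator simp: less_top[symmetric])
      ultimately show "\<exists>n. \<exists>Z'\<in>borel_measurable (F n). integrable M Z' \<and>
          expectation (\<lambda>x. \<bar>indicator A x *\<^sub>R c - Z' x\<bar>) \<le> \<delta>" by blast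
    qed
  next
    case (add f g)
    show ?case
    proof (intro allI impI)
      fix \<delta> :: real assume "\<delta> > 0"
      then have "\<delta> / 2 > 0" by simp
      obtain n1 f' where f': "f' \<in> borel_measurable (F n1)" "integrable M f'"
        "expectation (\<lambda>x. \<bar>f x - f' x\<bar>) \<le> \<delta> / 2"
        using add(3) \<open>\<delta> / 2 > 0\<close> by blast
      obtain n2 g' where g': "g' \<in> borel_measurable (F n2)" "integrable M g'"
        "expectation (\<lambda>x. \<bar>g x - g' x\<bar>) \<le> \<delta> / 2"
        using add(4) \<open>\<delta> / 2 > 0\<close> by blast
      note int = int_M[OF add(1)] int_M[OF add(2)] f'(2) g'(2)
      have "expectation (\<lambda>x. \<bar>f x + g x - (f' x + g' x)\<bar>)
          \<le> expectation (\<lambda>x. \<bar>f x - f' x\<bar> + \<bar>g x - g' x\<bar>)"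
        by (rule integral_mono) (use int in auto)
      also have "\<dots> = expectation (\<lambda>x. \<bar>f x - f' x\<bar>) + expectation (\<lambda>x. \<bar>g x - g' x\<bar>)"
        by (rule Bochner_Integration.integral_add) (use int in auto)
      finally have "expectation (\<lambda>x. \<bar>f x + g x - (f' x + g' x)\<bar>) \<le> \<delta>" using f'(3) g'(3) by linarith
      moreover have "f' \<in> borel_measurable (F (max n1 n2))" "g' \<in> borel_measurable (F (max n1 n2))"
        using measurable_from_subalg[OF mono f'(1)] measurable_from_subalg[OF mono g'(1)] by auto
      then have "(\<lambda>x. f' x + g' x) \<in> borel_measurable (F (max n1 n2))" by measurable
      ultimately show "\<exists>n. \<exists>Z'\<in>borel_measurable (F n). integrable M Z' \<and>
          expectation (\<lambda>x. \<bar>f x + g x - Z' x\<bar>) \<le> \<delta>"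
        using int by (intro exI[of _ "max n1 n2"] bexI[of _ "\<lambda>x. f' x + g' x"]) auto
    qed
  next
    case (lim f s)
    note int = int_M[OF lim(1)] int_M[OF lim(4)]
    have "(\<lambda>i. expectation (\<lambda>x. \<bar>f x - s i x\<bar>)) \<longlonglongrightarrow> expectation (\<lambda>x. 0)"
    proof (rule integral_dominated_convergence[where w = "\<lambda>x. 3 * \<bar>f x\<bar>"])
      show "AE x in M. (\<lambda>i. \<bar>f x - s i x\<bar>) \<longlonglongrightarrow> 0"
      proof (rule AE_I2)
        fix x assume "x \<in> space M"
        then have "(\<lambda>i. s i x) \<longlonglongrightarrow> f x" using lim(2) by (simp add: space_restr_to_subalg)
        then have "(\<lambda>i. \<bar>f x - s i x\<bar>) \<longlonglongrightarrow> \<bar>f x - f x\<bar>" by (intro tendsto_intros)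
        then show "(\<lambda>i. \<bar>f x - s i x\<bar>) \<longlonglongrightarrow> 0" by simp
      qed
      show "AE x in M. norm \<bar>f x - s i x\<bar> \<le> 3 * \<bar>f x\<bar>" for i
      proof (rule AE_I2)
        fix x assume "x \<in> space M"
        then have "\<bar>s i x\<bar> \<le> 2 * \<bar>f x\<bar>" using lim(3)[of x i] by (simp add: space_restr_to_subalg)
        then show "norm \<bar>f x - s i x\<bar> \<le> 3 * \<bar>f x\<bar>" by simp
      qed
    qed (use int in auto)
    then have conv: "(\<lambda>i. expectation (\<lambda>x. \<bar>f x - s i x\<bar>)) \<longlonglongrightarrow> 0" by simp
    show ?case
    proof (intro allI impI)
      fix \<delta> :: real assume "\<delta> > 0"
      then have "\<delta> / 2 > 0" by simp
      with order_tendstoD(2)[OF conv this] obtain i where i: "expectation (\<lambda>x. \<bar>f x - s i x\<bar>) < \<delta> / 2"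
        by (auto simp: eventually_sequentially)
      obtain n Z' where Z': "Z' \<in> borel_measurable (F n)" "integrable M Z'"
        "expectation (\<lambda>x. \<bar>s i x - Z' x\<bar>) \<le> \<delta> / 2"
        using lim(5) \<open>\<delta> / 2 > 0\<close> by blast
      have "expectation (\<lambda>x. \<bar>f x - Z' x\<bar>)
          \<le> expectation (\<lambda>x. \<bar>f x - s i x\<bar> + \<bar>s i x - Z' x\<bar>)"
        by (rule integral_mono) (use int Z'(2) in auto)
      also have "\<dots> = expectation (\<lambda>x. \<bar>f x - s i x\<bar>) + expectation (\<lambda>x. \<bar>s i x - Z' x\<bar>)"
        by (rule Bochner_Integration.integral_add) (use int Z'(2) in auto)
      finally have "expectation (\<lambda>x. \<bar>f x - Z' x\<bar>) \<le> \<delta>" using i Z'(3) by linarith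
      with Z' show "\<exists>n. \<exists>Z'\<in>borel_measurable (F n). integrable M Z' \<and>
          expectation (\<lambda>x. \<bar>f x - Z' x\<bar>) \<le> \<delta>" by blast
    qed
  qed
  with \<open>\<delta> > 0\<close> that show thesis by blast
qed

text \<open>
  Levy's upward theorem. Let \<open>Z = E(f | G)\<close> and let \<open>Z'\<close> be \<open>F m\<close>-measurable and close to \<open>Z\<close>
  in \<open>L\<^sup>1\<close>. For \<open>n \<ge> m\<close> the distance from \<open>E(f | F n) = E(Z | F n)\<close> to \<open>Z\<close> is at most
  \<open>E(W | F n) + W\<close> with \<open>W = \<bar>Z - Z'\<bar>\<close>. By the maximal inequality
  this is small for all \<open>n\<close> at once, outside a set of small probability.
\<close>

lemma levy_upward:
  fixes F :: "nat \<Rightarrow> 'a measure" and f :: "'a \<Rightarrow> real"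
  assumes sub: "\<And>n. subalgebra M (F n)"
    and mono: "\<And>m n. m \<le> n \<Longrightarrow> subalgebra (F n) (F m)"
    and G: "subalgebra M G" "\<And>n. subalgebra G (F n)"
      "sets G \<subseteq> sigma_sets (space M) (\<Union>n. sets (F n))"
    and f: "integrable M f"
  shows "AE x in M. (\<lambda>n. real_cond_exp M (F n) f x) \<longlonglongrightarrow> real_cond_exp M G f x"
proof -
  interpret G: sigma_finite_subalgebra M G by (rule cond_exp_subalgebra[OF G(1)])
  define Z where "Z = real_cond_exp M G f"
  define C where "C n = real_cond_exp M (F n) f" for n
  have Z_int: "integrable M Z" unfolding Z_def by (rule G.real_cond_exp_int[OF f])
  have [measurable]: "Z \<in> borel_measurable M" "C n \<in> borel_measurable M" for n
    unfolding Z_def C_def by measurable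
  have C_eq: "AE x in M. real_cond_exp M (F n) Z x = C n x" for n
  proof -
    interpret F: sigma_finite_subalgebra M "F n" by (rule cond_exp_subalgebra[OF sub])
    show ?thesis unfolding Z_def C_def by (rule F.real_cond_exp_nested_subalg[OF G(1,2) f])
  qed
  have ev: "AE x in M. \<exists>m. \<forall>n\<ge>m. \<bar>C n x - Z x\<bar> \<le> 2 * \<epsilon>" if \<epsilon>: "\<epsilon> > 0" for \<epsilon>
  proof -
    define B where "B = {x \<in> space M. \<not> (\<exists>m. \<forall>n\<ge>m. \<bar>C n x - Z x\<bar> \<le> 2 * \<epsilon>)}"
    have B [measurable]: "B \<in> sets M" unfolding B_def by measurable
    have "prob B \<le> 2 * \<delta> / \<epsilon>" if \<delta>: "\<delta> > 0" for \<delta>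
    proof -
      have "Z \<in> borel_measurable G" unfolding Z_def by measurable
      then obtain m Z' where Z': "Z' \<in> borel_measurable (F m)" "integrable M Z'"
        "expectation (\<lambda>x. \<bar>Z x - Z' x\<bar>) \<le> \<delta>"
        using filtration_approximates_function[of F G Z \<delta>, OF sub mono G(1,3) Z_int] \<delta> by metis
      define W where "W x = \<bar>Z x - Z' x\<bar>" for x
      have W_int: "integrable M W" unfolding W_def using Z_int Z'(2) by auto
      note [measurable] = borel_measurable_integrable[OF W_int]
      have close: "AE x in M. n \<ge> m \<longrightarrow> \<bar>C n x - Z x\<bar> \<le> real_cond_exp M (F n) W x + W x" for n
      proof (cases "n \<ge> m")
        case True
        interpret F: sigma_finite_subalgebra M "F n" by (rule cond_exp_subalgebra[OF sub])
        have "AE x in M. real_cond_exp M (F n) Z' x = Z' x"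
          by (rule F.real_cond_exp_F_meas[OF Z'(2) measurable_from_subalg[OF mono[OF True] Z'(1)]])
        moreover have "AE x in M. real_cond_exp M (F n) (\<lambda>x. Z x - Z' x) x
            = real_cond_exp M (F n) Z x - real_cond_exp M (F n) Z' x"
          by (rule F.real_cond_exp_diff[OF Z_int Z'(2)])
        moreover have "AE x in M. \<bar>real_cond_exp M (F n) (\<lambda>x. Z x - Z' x) x\<bar> \<le> real_cond_exp M (F n) W x"
          unfolding W_def by (rule cond_exp_abs_le[OF sub]) (use Z_int Z'(2) in auto)
        ultimately show ?thesis using C_eq[of n]
          by eventually_elim (auto simp: W_def)
      qed auto
      define B1 where "B1 = {x \<in> space M. \<exists>n. \<epsilon> < real_cond_exp M (F n) W x}"
      define B2 where "B2 = {x \<in> space M. \<epsilon> \<le> W x}"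
      have [measurable]: "B1 \<in> sets M" "B2 \<in> sets M" unfolding B1_def B2_def by measurable
      have "AE x in M. \<forall>n. n \<ge> m \<longrightarrow> \<bar>C n x - Z x\<bar> \<le> real_cond_exp M (F n) W x + W x"
        using close by (simp add: AE_all_countable)
      then have "AE x in M. x \<in> B \<longrightarrow> x \<in> B1 \<union> B2"
      proof eventually_elim
        case (elim x)
        show ?case
        proof
          assume xB: "x \<in> B"
          then obtain n where n: "n \<ge> m" "\<not> \<bar>C n x - Z x\<bar> \<le> 2 * \<epsilon>" unfolding B_def by blast
          have "\<bar>C n x - Z x\<bar> \<le> real_cond_exp M (F n) W x + W x" using elim n(1) by blast
          with n(2) have "\<epsilon> < real_cond_exp M (F n) W x \<or> \<epsilon> \<le> W x" by linarith
          with xB show "x \<in> B1 \<union> B2" unfolding B1_def B2_def B_def by blast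
        qed
      qed
      then have "prob B \<le> prob (B1 \<union> B2)" by (intro finite_measure_mono_AE) auto
      also have "\<dots> \<le> prob B1 + prob B2" by (rule measure_Un_le) auto
      also have "prob B1 \<le> expectation W / \<epsilon>"
        unfolding B1_def by (rule cond_exp_maximal_inequality[of F, OF sub mono W_int _ \<epsilon>]) (auto simp: W_def)
      also have "prob B2 \<le> expectation W / \<epsilon>"
        unfolding B2_def by (rule integral_Markov_inequality_measure[OF W_int, of "{}"]) (use \<epsilon> in \<open>auto simp: W_def\<close>)
      also have "expectation W / \<epsilon> + expectation W / \<epsilon> \<le> \<delta> / \<epsilon> + \<delta> / \<epsilon>"
        using Z'(3) \<epsilon> unfolding W_def by (intro add_mono divide_right_mono) auto
      finally show ?thesis by simp
    qed
    from this[of "\<delta> * \<epsilon> / 2" for \<delta>] have "prob B \<le> \<delta>" if "\<delta> > 0" for \<delta>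
      using that \<epsilon> by simp
    then have "prob B \<le> 0" by (rule field_le_epsilon[of _ 0, simplified])
    then have "prob B = 0" by (simp add: measure_le_0_iff)
    then have "B \<in> null_sets M" by (simp add: emeasure_eq_measure null_setsI)
    then show ?thesis by (rule AE_I') (auto simp: B_def)
  qed
  have "AE x in M. \<forall>k. \<exists>m. \<forall>n\<ge>m. \<bar>C n x - Z x\<bar> \<le> 2 * (1 / real (Suc k))"
    unfolding AE_all_countable by (intro allI ev) simp
  then show ?thesis
  proof eventually_elim
    case (elim x)
    show ?case
      unfolding LIMSEQ_def
    proof (intro allI impI)
      fix e :: real assume "e > 0"
      then obtain k where "1 / real (Suc k) < e / 2"
        using reals_Archimedean[of "e / 2"] by (auto simp: inverse_eq_divide)
      moreover obtain m where "\<forall>n\<ge>m. \<bar>C n x - Z x\<bar> \<le> 2 * (1 / real (Suc k))" using elim by blast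
      ultimately show "\<exists>m. \<forall>n\<ge>m. dist (real_cond_exp M (F n) f x) (real_cond_exp M G f x) < e"
        unfolding dist_real_def C_def Z_def by fastforce
    qed
  qed
qed

end

section \<open>Recurrence times of paths\<close>

definition right_shift :: "(int \<Rightarrow> real) \<Rightarrow> int \<Rightarrow> real" where
  "right_shift x = (\<lambda>n. x (n - 1))"

lemma left_shift_funpow: "(left_shift ^^ t) x = (\<lambda>n. x (n + int t))"
  by (induction t) (auto simp: left_shift_def algebra_simps)

lemma right_shift_funpow: "(right_shift ^^ t) x = (\<lambda>n. x (n - int t))"
  by (induction t) (auto simp: right_shift_def algebra_simps)

lemma left_right_shift [simp]: "left_shift (right_shift x) = x" "right_shift (left_shift x) = x"
  by (auto simp: left_shift_def right_shift_def)

definition recurs :: "(real \<Rightarrow> real set) \<Rightarrow> (int \<Rightarrow> real) \<Rightarrow> nat \<Rightarrow> nat \<Rightarrow> bool" where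
  "recurs G x l t \<longleftrightarrow> (\<forall>n\<in>{1..l}. G (x (- int n - int t)) = G (x (- int n)))"

lemma map_upto_shift_eq_iff:
  "map G (map x [- int l - int t .. - 1 - int t]) = map G (map x [- int l .. - 1]) \<longleftrightarrow> recurs G x l t"
proof -
  have "[- int l - int t .. - 1 - int t] = map (\<lambda>i. i - int t) [- int l .. - 1]"
    by (rule nth_equalityI) (auto simp: nth_upto)
  then have "map G (map x [- int l - int t .. - 1 - int t]) = map G (map x [- int l .. - 1]) \<longleftrightarrow>
      (\<forall>i\<in>{- int l .. - 1}. G (x (i - int t)) = G (x i))"
    by simp
  also have "\<dots> \<longleftrightarrow> recurs G x l t"
  proof -
    have "{- int l .. - 1} = (\<lambda>n. - int n) ` {1..l}"
    proof (intro equalityI subsetI)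
      fix i assume "i \<in> {- int l .. - 1}"
      then have "i = - int (nat (- i))" "nat (- i) \<in> {1..l}" by auto
      then show "i \<in> (\<lambda>n. - int n) ` {1..l}" by blast
    qed auto
    then show ?thesis by (simp add: recurs_def)
  qed
  finally show ?thesis .
qed

lemma recurrence_time_eq_enat_iff:
  "recurrence_time G x L = enat t \<longleftrightarrow>
     (\<exists>l. L = enat l \<and> 0 < t \<and> recurs G x l t \<and> (\<forall>s. 0 < s \<and> s < t \<longrightarrow> \<not> recurs G x l s))"
proof (cases "\<exists>l. L = enat l \<and> (\<exists>t>0. recurs G x l t)")
  case True
  then obtain l where l: "L = enat l" "\<exists>t>0. recurs G x l t" by blast
  obtain t0 where t0: "t0 > 0" "recurs G x l t0" "\<And>s. 0 < s \<Longrightarrow> s < t0 \<Longrightarrow> \<not> recurs G x l s"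
    using first_time_exists[OF l(2)] by metis
  have "recurrence_time G x L = enat t0"
    unfolding recurrence_time_def map_upto_shift_eq_iff l(1)
  proof (rule Inf_eqI)
    fix i assume "i \<in> {enat t | t. 0 < t \<and> (\<exists>l'. enat l = enat l' \<and> recurs G x l' t)}"
    then obtain t where "i = enat t" "0 < t" "recurs G x l t" by auto
    with t0(3) show "enat t0 \<le> i" by (metis enat_ord_simps(1) not_le)
  qed (use t0 in auto)
  then show ?thesis using l(1) t0 by (auto dest: t0(3)) (metis linorder_neqE_nat)
next
  case False
  then have "recurrence_time G x L = Inf {}"
    unfolding recurrence_time_def map_upto_shift_eq_iff by (intro arg_cong[of _ _ Inf]) blast
  with False show ?thesis by (auto simp: Inf_enat_def)
qed

lemma recurrence_time_infinity [simp]: "recurrence_time G x \<infinity> = \<infinity>"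
  by (rule ccontr) (auto simp: recurrence_time_eq_enat_iff)

lemma recurrence_time_eq_infinity_iff:
  "recurrence_time G x (enat l) = \<infinity> \<longleftrightarrow> (\<forall>t>0. \<not> recurs G x l t)"
proof
  assume inf: "recurrence_time G x (enat l) = \<infinity>"
  show "\<forall>t>0. \<not> recurs G x l t"
  proof (rule ccontr)
    assume "\<not> ?thesis"
    then have "\<exists>t>0. recurs G x l t" by blast
    then obtain t where "t > 0" "recurs G x l t" "\<And>s. 0 < s \<Longrightarrow> s < t \<Longrightarrow> \<not> recurs G x l s"
      using first_time_exists by metis
    then have "recurrence_time G x (enat l) = enat t" by (simp add: recurrence_time_eq_enat_iff)
    with inf show False by simp
  qed
next
  assume "\<forall>t>0. \<not> recurs G x l t"
  then show "recurrence_time G x (enat l) = \<infinity>"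
    by (metis enat.exhaust recurrence_time_eq_enat_iff enat.inject)
qed

lemma recurrence_time_ge_1: "1 \<le> recurrence_time G x L"
proof (cases "recurrence_time G x L")
  case (enat t)
  then show ?thesis
    using recurrence_time_eq_enat_iff[of G x L t] by (auto simp: one_enat_def)
qed simp

lemma lam_le_Suc: "lam \<P> x k \<le> lam \<P> x (Suc k)"
  by simp

lemma lam_mono: "j \<le> k \<Longrightarrow> lam \<P> x j \<le> lam \<P> x k"
  by (rule lift_Suc_mono_le[of "lam \<P> x"]) (rule lam_le_Suc)

lemma lam_gt: "enat (Suc k) \<le> lam \<P> x k"
proof (induction k)
  case (Suc k)
  have "1 + enat (Suc k) \<le> recurrence_time (quantizer (\<P> (Suc k))) x (lam \<P> x k) + lam \<P> x k"
    by (intro add_mono recurrence_time_ge_1 Suc)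
  then show ?case by (simp add: one_enat_def)
qed (simp add: one_enat_def)

lemma lam_Suc_tau: "lam \<P> x (Suc k) = tau \<P> x (Suc k) + lam \<P> x k"
  by (simp add: tau_def)

lemma tau_finite:
  assumes "lam \<P> x (Suc k) \<noteq> \<infinity>"
  obtains t l where "tau \<P> x (Suc k) = enat t" "lam \<P> x k = enat l" "lam \<P> x (Suc k) = enat (t + l)"
    "t > 0" "recurs (quantizer (\<P> (Suc k))) x l t"
    "\<And>s. 0 < s \<Longrightarrow> s < t \<Longrightarrow> \<not> recurs (quantizer (\<P> (Suc k))) x l s"
proof -
  from assms obtain t where t: "tau \<P> x (Suc k) = enat t"
    unfolding lam_Suc_tau by (cases "tau \<P> x (Suc k)") auto
  then obtain l where "lam \<P> x k = enat l" "0 < t" "recurs (quantizer (\<P> (Suc k))) x l t"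
    "\<forall>s. 0 < s \<and> s < t \<longrightarrow> \<not> recurs (quantizer (\<P> (Suc k))) x l s"
    by (auto simp: tau_def recurrence_time_eq_enat_iff)
  with t that show thesis unfolding lam_Suc_tau by simp
qed

context partitions
begin

text \<open>
  \<open>\<lambda>\<^sub>k\<close> and \<open>\<tau>\<^sub>k\<close> are stopping times of the quantized past: the block of length \<open>\<lambda>\<^sub>k\<close> read at
  resolution \<open>k\<close> determines them, because it contains the recurrence that ends the search. An
  infinite \<open>\<lambda>\<^sub>k\<close> is determined by the whole past.
\<close>

lemma lam_tau_cong:
  assumes "\<And>n. 1 \<le> n \<Longrightarrow> enat n \<le> lam \<P> x k \<Longrightarrow> Q k (x (- int n)) = Q k (y (- int n))"
  shows "lam \<P> y k = lam \<P> x k" "k \<ge> 1 \<Longrightarrow> tau \<P> y k = tau \<P> x k"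
proof -
  have "lam \<P> y k = lam \<P> x k \<and> (k \<ge> 1 \<longrightarrow> tau \<P> y k = tau \<P> x k)"
    using assms
  proof (induction k)
    case (Suc k)
    have lam_k: "lam \<P> y k = lam \<P> x k"
    proof (cases "k = 0")
      case False
      show ?thesis
      proof (rule Suc.IH[THEN conjunct1])
        fix n assume n: "1 \<le> n" "enat n \<le> lam \<P> x k"
        have "enat n \<le> lam \<P> x (Suc k)" using n(2) lam_le_Suc[of \<P> x k] by (rule order_trans)
        from Suc.prems[OF n(1) this] show "Q k (x (- int n)) = Q k (y (- int n))"
          using False by (intro Q_refine[of k "Suc k"]) auto
      qed
    qed simp
    have "tau \<P> y (Suc k) = tau \<P> x (Suc k)"
    proof (cases "lam \<P> x k")
      case (enat l)
      have same: "recurs (Q (Suc k)) y l s \<longleftrightarrow> recurs (Q (Suc k)) x l s"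
        if "enat (s + l) \<le> lam \<P> x (Suc k)" for s
      proof -
        have eq: "Q (Suc k) (x (- int n)) = Q (Suc k) (y (- int n))" if "1 \<le> n" "n \<le> s + l" for n
          using that \<open>enat (s + l) \<le> lam \<P> x (Suc k)\<close>
          by (intro Suc.prems) (auto intro: order_trans[of "enat n" "enat (s + l)"])
        have "Q (Suc k) (x (- int n - int s)) = Q (Suc k) (y (- int n - int s))" if "n \<in> {1..l}" for n
          using eq[of "n + s"] that by (simp add: algebra_simps)
        with eq show ?thesis by (auto simp: recurs_def)
      qed
      show ?thesis
      proof (cases "lam \<P> x (Suc k)")
        case (enat n)
        then have "lam \<P> x (Suc k) \<noteq> \<infinity>" by simp
        then obtain t l' where t: "tau \<P> x (Suc k) = enat t" "lam \<P> x k = enat l'"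
          "lam \<P> x (Suc k) = enat (t + l')" "t > 0" "recurs (Q (Suc k)) x l' t"
          "\<And>s. 0 < s \<Longrightarrow> s < t \<Longrightarrow> \<not> recurs (Q (Suc k)) x l' s"
          by (rule tau_finite) blast
        have l': "l' = l" using t(2) \<open>lam \<P> x k = enat l\<close> by simp
        have "tau \<P> y (Suc k) = enat t"
          unfolding tau_def diff_Suc_1 recurrence_time_eq_enat_iff lam_k \<open>lam \<P> x k = enat l\<close>
          using t(3-6) same unfolding l' by auto
        with t(1) show ?thesis by simp
      next
        case infinity
        then have "tau \<P> x (Suc k) = \<infinity>"
          using \<open>lam \<P> x k = enat l\<close> unfolding lam_Suc_tau by (cases "tau \<P> x (Suc k)") auto
        moreover have "recurs (Q (Suc k)) y l s \<longleftrightarrow> recurs (Q (Suc k)) x l s" for s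
          by (rule same) (simp only: infinity enat_ord_simps)
        ultimately show ?thesis
          unfolding tau_def diff_Suc_1 lam_k \<open>lam \<P> x k = enat l\<close>
          using recurrence_time_eq_infinity_iff by metis
      qed
    qed (simp add: tau_def lam_k)
    then show ?case using lam_k by (simp add: lam_Suc_tau del: lam.simps(2))
  qed simp
  then show "lam \<P> y k = lam \<P> x k" "k \<ge> 1 \<Longrightarrow> tau \<P> y k = tau \<P> x k" by auto
qed

text \<open>
  Two paths are equivalent at stage \<open>k\<close> if they carry the same information for the
  choice of \<open>\<tau>\<^bsub>k+1\<^esub>\<close>: the block of length \<open>\<lambda>\<^sub>k\<close>, at resolution \<open>k + 1\<close>. Where \<open>\<lambda>\<^sub>k\<close> is infinite this
  is the whole quantized past, so that equivalence gets finer as \<open>k\<close> grows on every path.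
\<close>

definition same_block :: "nat \<Rightarrow> (int \<Rightarrow> real) \<Rightarrow> (int \<Rightarrow> real) \<Rightarrow> bool" where
  "same_block k x y \<longleftrightarrow>
     (\<forall>n\<ge>1. enat n \<le> lam \<P> x k \<longrightarrow> Q (Suc k) (x (- int n)) = Q (Suc k) (y (- int n)))"

lemma same_block_mono:
  assumes "j \<le> k" "same_block k x y"
  shows "same_block j x y"
  unfolding same_block_def
proof (intro allI impI)
  fix n assume "1 \<le> n" "enat n \<le> lam \<P> x j"
  moreover from this have "enat n \<le> lam \<P> x k" using lam_mono[OF assms(1)] order_trans by blast
  ultimately show "Q (Suc j) (x (- int n)) = Q (Suc j) (y (- int n))"
    using assms by (intro Q_refine[of "Suc j" "Suc k"]) (auto simp: same_block_def)
qed

lemma same_block_lam: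
  assumes "same_block k x y"
  shows "lam \<P> y k = lam \<P> x k"
proof (cases "k = 0")
  case False
  show ?thesis
  proof (rule lam_tau_cong(1))
    fix n assume "1 \<le> n" "enat n \<le> lam \<P> x k"
    with assms have "Q (Suc k) (x (- int n)) = Q (Suc k) (y (- int n))" by (simp add: same_block_def)
    with False show "Q k (x (- int n)) = Q k (y (- int n))" by (intro Q_refine[of k "Suc k"]) auto
  qed
qed simp

text \<open>
  The same information as a label in a countable set, as the recurrence argument demands. Paths
  with infinite \<open>\<lambda>\<^sub>k\<close>, which will turn out to form a null set, share the label \<open>[]\<close>.
\<close>

definition block :: "nat \<Rightarrow> (int \<Rightarrow> real) \<Rightarrow> real set list" where
  "block k x = (case lam \<P> x k of enat l \<Rightarrow> map (\<lambda>n. Q (Suc k) (x (- int n))) [1..<Suc l] | \<infinity> \<Rightarrow> [])"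

text \<open>
  Recurrence of the block is a return of the path to its label under the shift. The length of a label
  is \<open>\<lambda>\<^sub>k\<close>, so equal labels mean equal blocks; conversely an equal block forces the same \<open>\<lambda>\<^sub>k\<close>, as
  \<open>\<lambda>\<^sub>k\<close> is a stopping time.
\<close>

lemma block_shift_eq_iff:
  assumes l: "lam \<P> x k = enat l"
  shows "block k ((right_shift ^^ t) x) = block k x \<longleftrightarrow> recurs (Q (Suc k)) x l t"
proof -
  let ?y = "(right_shift ^^ t) x"
  have l1: "l \<ge> 1" using lam_gt[of k \<P> x] l by simp
  show ?thesis
  proof
    assume eq: "block k ?y = block k x"
    have "length (block k x) = l" using l by (simp add: block_def)
    then have "length (block k ?y) = l" using eq by simp
    with l1 have "lam \<P> ?y k = enat l" by (auto simp: block_def split: enat.splits)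
    with eq l show "recurs (Q (Suc k)) x l t"
      by (simp add: block_def recurs_def right_shift_funpow atLeastLessThanSuc_atLeastAtMost del: upt_Suc)
  next
    assume rec: "recurs (Q (Suc k)) x l t"
    then have "same_block k x ?y"
      using l by (simp add: same_block_def recurs_def right_shift_funpow)
    then have "lam \<P> ?y k = enat l" using same_block_lam l by metis
    with rec l show "block k ?y = block k x"
      by (simp add: block_def recurs_def right_shift_funpow atLeastLessThanSuc_atLeastAtMost del: upt_Suc)
  qed
qed

lemma measurable_coordinate [measurable]: "(\<lambda>x. x i) \<in> borel_measurable path_space"
  by (rule measurable_component_singleton) simp

lemma measurable_Q_coordinate:
  "k \<ge> 1 \<Longrightarrow> (\<lambda>x. Q k (x i)) \<in> path_space \<rightarrow>\<^sub>M count_space (\<P> k)"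
  using measurable_compose[OF measurable_coordinate measurable_Q] .

lemma pred_Q_eq:
  assumes "k \<ge> 1"
  shows "Measurable.pred path_space (\<lambda>x. Q k (x i) = A)"
proof -
  have "Measurable.pred (count_space (\<P> k)) (\<lambda>B. B = A)" by simp
  from measurable_compose[OF measurable_Q_coordinate[OF assms] this] show ?thesis .
qed

lemma pred_Q_eq_Q:
  assumes "k \<ge> 1"
  shows "Measurable.pred path_space (\<lambda>x. Q k (x i) = Q k (x j))"
proof -
  have "Measurable.pred path_space (\<lambda>x. \<exists>A\<in>\<P> k. Q k (x i) = A \<and> Q k (x j) = A)"
    by (intro pred_intros_finite pred_intros_logic pred_Q_eq assms finite_P)
  moreover have "(\<exists>A\<in>\<P> k. Q k (x i) = A \<and> Q k (x j) = A) \<longleftrightarrow> Q k (x i) = Q k (x j)" for x :: "int \<Rightarrow> real"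
    using quantizer_mem(1)[OF partition_P[OF assms]] by metis
  ultimately show ?thesis by simp
qed

lemma pred_recurs: "k \<ge> 1 \<Longrightarrow> Measurable.pred path_space (\<lambda>x. recurs (Q k) x l t)"
  unfolding recurs_def by (intro pred_intros_countable_bounded pred_Q_eq_Q) auto

lemma pred_recurrence_time:
  "k \<ge> 1 \<Longrightarrow> Measurable.pred path_space (\<lambda>x. recurrence_time (Q k) x (enat l) = enat t)"
  unfolding recurrence_time_eq_enat_iff
  by (intro pred_intros_logic pred_intros_countable pred_recurs) auto

lemma pred_lam: "Measurable.pred path_space (\<lambda>x. lam \<P> x k = enat n)"
proof (induction k arbitrary: n)
  case (Suc k)
  have "lam \<P> x (Suc k) = enat n \<longleftrightarrow>
      (\<exists>l\<in>{..n}. lam \<P> x k = enat l \<and> recurrence_time (Q (Suc k)) x (enat l) = enat (n - l))" for x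
  proof
    assume "lam \<P> x (Suc k) = enat n"
    then show "\<exists>l\<in>{..n}. lam \<P> x k = enat l \<and> recurrence_time (Q (Suc k)) x (enat l) = enat (n - l)"
      by (cases "lam \<P> x k"; cases "recurrence_time (Q (Suc k)) x (lam \<P> x k)") auto
  qed auto
  then show ?case
    by (simp only:) (intro pred_intros_countable_bounded pred_intros_logic Suc pred_recurrence_time, auto)
qed simp

lemma measurable_enat_valued:
  assumes "\<And>n. Measurable.pred M (\<lambda>x. f x = enat n)"
  shows "f \<in> M \<rightarrow>\<^sub>M count_space UNIV"
proof (subst measurable_count_space_eq_countable, safe)
  fix e :: enat
  show "f -` {e} \<inter> space M \<in> sets M"
  proof (cases e)
    case (enat n)
    have "f -` {e} \<inter> space M = {x \<in> space M. f x = enat n}" using enat by auto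
    then show ?thesis using assms[of n] by (simp add: pred_def)
  next
    case infinity
    have "f -` {e} \<inter> space M = space M - (\<Union>n. {x \<in> space M. f x = enat n})"
      using infinity by (auto simp: not_enat_eq)
    then show ?thesis using assms by (auto simp: pred_def)
  qed
qed auto

lemma measurable_lam [measurable]: "(\<lambda>x. lam \<P> x k) \<in> path_space \<rightarrow>\<^sub>M count_space UNIV"
  by (rule measurable_enat_valued[OF pred_lam])

lemma measurable_tau:
  assumes "k \<ge> 1"
  shows "(\<lambda>x. tau \<P> x k) \<in> path_space \<rightarrow>\<^sub>M count_space UNIV"
proof (rule measurable_enat_valued)
  fix n
  have "tau \<P> x k = enat n \<longleftrightarrow> (\<exists>l. lam \<P> x (k - 1) = enat l \<and> recurrence_time (Q k) x (enat l) = enat n)" for x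
    unfolding tau_def by (cases "lam \<P> x (k - 1)") auto
  then show "Measurable.pred path_space (\<lambda>x. tau \<P> x k = enat n)"
    by (simp only:) (intro pred_intros_countable pred_intros_logic pred_lam pred_recurrence_time assms)
qed

lemma measurable_block: "block k \<in> path_space \<rightarrow>\<^sub>M count_space (lists (\<P> (Suc k)))"
proof -
  have countable: "countable (lists (\<P> (Suc k)))" by (simp add: countable_finite finite_P)
  show ?thesis
    unfolding measurable_count_space_eq_countable[OF countable]
  proof (intro conjI funcsetI ballI)
    fix x :: "int \<Rightarrow> real"
    show "block k x \<in> lists (\<P> (Suc k))"
      using quantizer_mem(1)[OF partition_P[of "Suc k"]]
      by (auto simp: block_def split: enat.splits)
  next
    fix b
    have map_eq: "map (\<lambda>n. Q (Suc k) (x (- int n))) [1..<Suc l] = b \<longleftrightarrow>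
        length b = l \<and> (\<forall>j\<in>{..<l}. Q (Suc k) (x (- int (Suc j))) = b ! j)" for x :: "int \<Rightarrow> real" and l
      by (auto simp: list_eq_iff_nth_eq simp del: upt_Suc)
    have "block k x = b \<longleftrightarrow> (lam \<P> x k = \<infinity> \<and> b = []) \<or>
        (\<exists>l. lam \<P> x k = enat l \<and> length b = l \<and> (\<forall>j\<in>{..<l}. Q (Suc k) (x (- int (Suc j))) = b ! j))" for x
    proof (cases "lam \<P> x k")
      case (enat l)
      then have "block k x = map (\<lambda>n. Q (Suc k) (x (- int n))) [1..<Suc l]" by (simp add: block_def)
      then show ?thesis using enat by (simp only: map_eq) auto
    qed (auto simp: block_def)
    moreover have "Measurable.pred path_space (\<lambda>x. (lam \<P> x k = \<infinity> \<and> b = []) \<or>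
        (\<exists>l. lam \<P> x k = enat l \<and> length b = l \<and> (\<forall>j\<in>{..<l}. Q (Suc k) (x (- int (Suc j))) = b ! j)))"
    proof -
      have [measurable]: "Measurable.pred path_space (\<lambda>x. Q (Suc k) (x i) = A)" for i A
        by (rule pred_Q_eq) simp
      note [measurable] = pred_lam
      have 1: "Measurable.pred path_space (\<lambda>x. lam \<P> x k = \<infinity> \<and> b = [])" by measurable
      have 2: "Measurable.pred path_space (\<lambda>x. lam \<P> x k = enat l \<and> length b = l \<and>
          (\<forall>j\<in>{..<l}. Q (Suc k) (x (- int (Suc j))) = b ! j))" for l
        by measurable
      show ?thesis
        using 1 2 unfolding pred_def by (intro sets.sets_Collect_disj sets.sets_Collect_countable_Ex)
    qed
    ultimately have "{x \<in> space path_space. block k x = b} \<in> sets path_space"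
      by (simp only: pred_def)
    moreover have "block k -` {b} \<inter> space path_space = {x \<in> space path_space. block k x = b}" by blast
    ultimately show "block k -` {b} \<inter> space path_space \<in> sets path_space" by (simp only:)
  qed
qed

end

section \<open>The stationary path measure\<close>

lemma cesaro_mean_0:
  fixes a :: "nat \<Rightarrow> real"
  assumes "a \<longlonglongrightarrow> 0"
  shows "(\<lambda>k. (\<Sum>j<k. a j) / real k) \<longlonglongrightarrow> 0"
proof (rule LIMSEQ_I)
  fix r :: real assume "r > 0"
  then obtain m where m: "\<And>j. j \<ge> m \<Longrightarrow> \<bar>a j\<bar> < r / 2"
    using LIMSEQ_D[OF assms, of "r / 2"] by auto
  define C where "C = (\<Sum>j<m. \<bar>a j\<bar>)"
  have "(\<lambda>k. C / real k) \<longlonglongrightarrow> 0" by (rule lim_const_over_n)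
  then obtain k0 where k0: "\<And>k. k \<ge> k0 \<Longrightarrow> \<bar>C / real k\<bar> < r / 2"
    using LIMSEQ_D[of "\<lambda>k. C / real k" 0 "r / 2"] \<open>r > 0\<close> by auto
  show "\<exists>no. \<forall>k\<ge>no. norm ((\<Sum>j<k. a j) / real k - 0) < r"
  proof (intro exI allI impI)
    fix k assume k: "k \<ge> max (Suc m) k0"
    have "\<bar>C / real k\<bar> < r / 2" using k by (intro k0) simp
    then have small: "C / real k + r / 2 < r" by linarith
    have "\<bar>\<Sum>j<k. a j\<bar> \<le> (\<Sum>j<k. \<bar>a j\<bar>)" by (rule sum_abs)
    also have "\<dots> = C + (\<Sum>j\<in>{m..<k}. \<bar>a j\<bar>)"
      unfolding C_def lessThan_atLeast0 using k by (intro sum.atLeastLessThan_concat[symmetric]) auto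
    also have "(\<Sum>j\<in>{m..<k}. \<bar>a j\<bar>) \<le> (\<Sum>j\<in>{m..<k}. r / 2)"
      by (intro sum_mono) (use m in \<open>force intro: less_imp_le\<close>)
    also have "\<dots> \<le> real k * (r / 2)" using \<open>r > 0\<close> by (simp add: mult_right_mono)
    finally have "\<bar>\<Sum>j<k. a j\<bar> / real k \<le> (C + real k * (r / 2)) / real k"
      by (intro divide_right_mono) auto
    also have "\<dots> = C / real k + r / 2" using k by (simp add: add_divide_distrib)
    also have "\<dots> < r" by (rule small)
    finally show "norm ((\<Sum>j<k. a j) / real k - 0) < r" by simp
  qed
qed

lemma cesaro_mean:
  fixes a :: "nat \<Rightarrow> real"
  assumes "a \<longlonglongrightarrow> L"
  shows "(\<lambda>k. (\<Sum>j<k. a j) / real k) \<longlonglongrightarrow> L"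
proof -
  have "(\<lambda>k. (\<Sum>j<k. a j - L) / real k + L) \<longlonglongrightarrow> 0 + L"
    using assms by (intro tendsto_add cesaro_mean_0 tendsto_const) (simp add: LIM_zero)
  moreover have "\<forall>\<^sub>F k in sequentially. (\<Sum>j<k. a j - L) / real k + L = (\<Sum>j<k. a j) / real k"
    using eventually_gt_at_top[of 0]
    by eventually_elim (simp add: sum_subtractf diff_divide_distrib)
  ultimately show ?thesis using Lim_transform_eventually by fastforce
qed

lemma kappa_eq_iff:
  assumes "t \<ge> 1"
  shows "kappa \<P> x t = k \<longleftrightarrow> lam \<P> x k \<le> enat t \<and> \<not> lam \<P> x (Suc k) \<le> enat t"
proof -
  let ?K = "{k. lam \<P> x k \<le> enat t}"
  have "?K \<subseteq> {..t}"
  proof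
    fix k assume "k \<in> ?K"
    then have "enat (Suc k) \<le> enat t" using lam_gt[of k \<P> x] order_trans by blast
    then show "k \<in> {..t}" by simp
  qed
  then have fin: "finite ?K" by (rule finite_subset) simp
  have ne: "?K \<noteq> {}" using assms by (auto simp: one_enat_def intro: exI[of _ 0])
  show ?thesis
  proof
    assume "kappa \<P> x t = k"
    then have "k \<in> ?K" "Suc k \<notin> ?K"
      using Max_in[OF fin ne] Max_ge[OF fin, of "Suc k"] unfolding kappa_def by auto
    then show "lam \<P> x k \<le> enat t \<and> \<not> lam \<P> x (Suc k) \<le> enat t" by blast
  next
    assume k: "lam \<P> x k \<le> enat t \<and> \<not> lam \<P> x (Suc k) \<le> enat t"
    have "j \<le> k" if "lam \<P> x j \<le> enat t" for j
      using that k lam_mono[of "Suc k" j \<P> x] by (meson not_less_eq_eq order_trans)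
    then show "kappa \<P> x t = k" unfolding kappa_def by (intro Max_eqI fin) (use k in auto)
  qed
qed

lemma measurable_left_shift: "left_shift \<in> path_space \<rightarrow>\<^sub>M path_space"
  unfolding left_shift_def by (rule measurable_PiM_single') (auto simp: space_PiM)

lemma measurable_right_shift: "right_shift \<in> path_space \<rightarrow>\<^sub>M path_space"
  unfolding right_shift_def by (rule measurable_PiM_single') (auto simp: space_PiM)

context partitions
begin

lemma measurable_kappa:
  assumes "t \<ge> 1"
  shows "(\<lambda>x. kappa \<P> x t) \<in> path_space \<rightarrow>\<^sub>M count_space UNIV"
proof (subst measurable_count_space_eq_countable, safe)
  fix k
  have "(\<lambda>x. kappa \<P> x t) -` {k} \<inter> space path_space
      = {x \<in> space path_space. lam \<P> x k \<le> enat t \<and> \<not> lam \<P> x (Suc k) \<le> enat t}"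
    unfolding vimage_def by (simp only: singleton_iff kappa_eq_iff[OF assms]) blast
  also have "\<dots> \<in> sets path_space" by measurable
  finally show "(\<lambda>x. kappa \<P> x t) -` {k} \<inter> space path_space \<in> sets path_space" .
qed auto

lemma measurable_recurrence_value:
  assumes "j \<ge> 1"
  shows "(\<lambda>x. x (- int (the_enat (tau \<P> x j)))) \<in> borel_measurable path_space"
  by (rule measurable_compose_countable[OF _ measurable_tau[OF assms],
        of "\<lambda>e x. x (- int (the_enat e))"]) measurable

lemma measurable_backward_estimator:
  assumes "t \<ge> 1"
  shows "backward_estimator \<P> t \<in> borel_measurable path_space"
  unfolding backward_estimator_def
proof (rule measurable_compose_countable[OF _ measurable_kappa[OF assms], of
        "\<lambda>k x. if k = 0 then 0 else (\<Sum>j = 1..k. x (- int (the_enat (tau \<P> x j)))) / real k"])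
  fix k :: nat
  show "(\<lambda>x. if k = 0 then 0 else (\<Sum>j = 1..k. x (- int (the_enat (tau \<P> x j)))) / real k)
      \<in> borel_measurable path_space"
    by (cases "k = 0")
       (auto intro!: borel_measurable_divide borel_measurable_sum measurable_recurrence_value)
qed

text \<open>
  Quantization with real values. Representatives are taken in \<open>[-D, D]\<close>, where the mesh is uniformly
  small; the process almost surely visits no other cell.
\<close>

definition representative :: "real \<Rightarrow> nat \<Rightarrow> real \<Rightarrow> real" where
  "representative D k x =
     (if \<exists>r\<in>Q (Suc k) x. \<bar>r\<bar> \<le> D then SOME r. r \<in> Q (Suc k) x \<and> \<bar>r\<bar> \<le> D else 0)"

lemma measurable_representative [measurable]: "representative D k \<in> borel_measurable borel"
proof -
  let ?r = "\<lambda>A. if \<exists>r\<in>A. \<bar>r\<bar> \<le> D then SOME r. r \<in> A \<and> \<bar>r\<bar> \<le> D else 0"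
  have "?r \<in> count_space (\<P> (Suc k)) \<rightarrow>\<^sub>M borel" by simp
  then have "(\<lambda>x. ?r (Q (Suc k) x)) \<in> borel_measurable borel"
    by (rule measurable_compose[rotated]) (simp add: measurable_Q)
  then show ?thesis by (simp add: representative_def[abs_def])
qed

lemma representative_cong: "Q (Suc k) x = Q (Suc k) y \<Longrightarrow> representative D k x = representative D k y"
  by (simp add: representative_def)

lemma abs_representative_le: "0 \<le> D \<Longrightarrow> \<bar>representative D k x\<bar> \<le> D"
  unfolding representative_def by (auto intro: someI2_bex[where Q = "\<lambda>r. \<bar>r\<bar> \<le> D"] simp: Bex_def)

lemma Q_representative:
  assumes "\<bar>x\<bar> \<le> D"
  shows "Q (Suc k) (representative D k x) = Q (Suc k) x"
proof -
  have part: "partition_on UNIV (\<P> (Suc k))" by (rule partition_P) simp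
  have ex: "\<exists>r. r \<in> Q (Suc k) x \<and> \<bar>r\<bar> \<le> D" using quantizer_mem(2)[OF part] assms by blast
  then have "representative D k x \<in> Q (Suc k) x"
    using someI_ex[OF ex] by (auto simp: representative_def)
  then show ?thesis by (rule quantizer_eqI[OF part quantizer_mem(1)[OF part]])
qed

end

locale stationary_paths = partitions \<P> + prob_space \<mu>
  for \<P> :: "nat \<Rightarrow> real set set" and \<mu> :: "(int \<Rightarrow> real) measure" +
  fixes D :: real
  assumes sets_\<mu> [measurable_cong]: "sets \<mu> = sets path_space"
    and shift_inv: "distr \<mu> \<mu> left_shift = \<mu>"
    and bounded_0: "AE x in \<mu>. \<bar>x 0\<bar> \<le> D"
begin

lemma space_\<mu> [simp]: "space \<mu> = UNIV"
  using sets_eq_imp_space_eq[OF sets_\<mu>] by (simp add: space_PiM)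

lemma measurable_\<mu>: "f \<in> path_space \<rightarrow>\<^sub>M N \<Longrightarrow> f \<in> \<mu> \<rightarrow>\<^sub>M N"
  using measurable_cong_sets[OF sets_\<mu> refl] by blast

lemma measurable_shifts [measurable]: "left_shift \<in> \<mu> \<rightarrow>\<^sub>M \<mu>" "right_shift \<in> \<mu> \<rightarrow>\<^sub>M \<mu>"
  using measurable_left_shift measurable_right_shift measurable_cong_sets[OF sets_\<mu> sets_\<mu>] by blast+

lemma right_shift_inv: "distr \<mu> \<mu> right_shift = \<mu>"
proof -
  have "distr \<mu> \<mu> right_shift = distr (distr \<mu> \<mu> left_shift) \<mu> right_shift"
    by (simp add: shift_inv)
  also have "\<dots> = \<mu>" by (subst distr_distr) (auto simp: o_def)
  finally show ?thesis .
qed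

lemma D_nonneg: "D \<ge> 0"
proof (rule ccontr)
  assume "\<not> D \<ge> 0"
  then have "AE x in \<mu>. False" by (intro eventually_mono[OF bounded_0]) auto
  then show False by simp
qed

lemma AE_lam_finite_step:
  assumes "AE x in \<mu>. lam \<P> x k \<noteq> \<infinity>"
  shows "AE x in \<mu>. lam \<P> x (Suc k) \<noteq> \<infinity>"
proof -
  have "countable (lists (\<P> (Suc k)))" by (simp add: countable_finite finite_P)
  from poincare_recurrence_label[OF measurable_shifts(2) right_shift_inv measurable_\<mu>[OF measurable_block] this]
  have "AE x in \<mu>. \<exists>t>0. block k ((right_shift ^^ t) x) = block k x" .
  then show ?thesis using assms
  proof eventually_elim
    case (elim x)
    then obtain l where l: "lam \<P> x k = enat l" by blast
    then have "\<exists>t>0. recurs (Q (Suc k)) x l t" using elim(1) block_shift_eq_iff by blast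
    then have "recurrence_time (Q (Suc k)) x (enat l) \<noteq> \<infinity>" by (metis recurrence_time_eq_infinity_iff)
    with l show ?case by auto
  qed
qed

text \<open>Poincare recurrence makes all the recurrence times finite almost surely.\<close>

lemma AE_lam_finite: "AE x in \<mu>. \<forall>k. lam \<P> x k \<noteq> \<infinity>"
proof -
  have "AE x in \<mu>. lam \<P> x k \<noteq> \<infinity>" for k
  proof (induction k)
    case (Suc k)
    then show ?case by (rule AE_lam_finite_step)
  qed (simp add: one_enat_def)
  then show ?thesis by (simp add: AE_all_countable)
qed

text \<open>
  The map \<open>return k\<close> moves the path to the recurrence of its block, so that \<open>X\<^bsub>-\<tau>\<^esub>\<close> with \<open>\<tau> = \<tau>\<^bsub>k+1\<^esub>\<close> is the
  coordinate \<open>0\<close> of \<open>return k x\<close>.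
\<close>

definition ret :: "nat \<Rightarrow> (int \<Rightarrow> real) \<Rightarrow> nat" where
  "ret k x = the_enat (tau \<P> x (Suc k))"

definition return :: "nat \<Rightarrow> (int \<Rightarrow> real) \<Rightarrow> int \<Rightarrow> real" where
  "return k x = (right_shift ^^ ret k x) x"

lemma return_0: "return k x 0 = x (- int (ret k x))"
  by (simp add: return_def right_shift_funpow)

lemma measurable_ret [measurable]: "ret k \<in> \<mu> \<rightarrow>\<^sub>M count_space UNIV"
  unfolding ret_def by (rule measurable_compose[OF measurable_\<mu>[OF measurable_tau]]) auto

lemma measurable_return [measurable]: "return k \<in> \<mu> \<rightarrow>\<^sub>M \<mu>"
  unfolding return_def
  by (rule measurable_compose_countable[OF _ measurable_ret, of "\<lambda>n x. (right_shift ^^ n) x"]) measurable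

lemma measurable_coordinate_\<mu> [measurable]: "(\<lambda>x. x i) \<in> borel_measurable \<mu>"
  by (rule measurable_\<mu>[OF measurable_coordinate])

text \<open>
  The heart of the construction: since \<open>return k\<close> also keeps the block (\<open>same_block_return\<close>), this
  identity says that \<open>X\<^bsub>-\<tau>\<^esub>\<close> given the block has the same law as \<open>X\<^sub>0\<close> given the block.
\<close>

lemma distr_return: "distr \<mu> \<mu> (return k) = \<mu>"
  unfolding return_def
proof (rule distr_return_map[where T = left_shift and \<phi> = "block k" and K = "lists (\<P> (Suc k))"])
  show "countable (lists (\<P> (Suc k)))" by (simp add: countable_finite finite_P)
  show "AE x in \<mu>. 0 < ret k x \<and> block k ((right_shift ^^ ret k x) x) = block k x \<and>
      (\<forall>s. 0 < s \<and> s < ret k x \<longrightarrow> block k ((right_shift ^^ s) x) \<noteq> block k x)"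
    using AE_lam_finite
  proof eventually_elim
    case (elim x)
    then have "lam \<P> x (Suc k) \<noteq> \<infinity>" by blast
    then show ?case
      by (rule tau_finite) (simp add: ret_def block_shift_eq_iff)
  qed
qed (auto simp: shift_inv right_shift_inv measurable_\<mu>[OF measurable_block])

lemma same_block_return:
  assumes "lam \<P> x (Suc k) \<noteq> \<infinity>"
  shows "same_block k x (return k x)"
  using assms
  by (rule tau_finite) (simp add: same_block_def return_def ret_def right_shift_funpow recurs_def)

definition stage :: "nat \<Rightarrow> (int \<Rightarrow> real) measure" where
  "stage k = inv_algebra \<mu> (same_block k)"

definition past :: "(int \<Rightarrow> real) measure" where
  "past = inv_algebra \<mu> (\<lambda>x y. \<forall>i<0. x i = y i)"

lemma subalgebra_stage: "subalgebra \<mu> (stage k)"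
  unfolding stage_def by (rule subalgebra_inv_algebra)

lemma subalgebra_past: "subalgebra \<mu> past"
  unfolding past_def by (rule subalgebra_inv_algebra)

lemma stage_mono: "j \<le> k \<Longrightarrow> subalgebra (stage k) (stage j)"
  unfolding stage_def by (rule subalgebra_inv_algebra_mono) (rule same_block_mono)

lemma stage_le_past: "subalgebra past (stage k)"
  unfolding stage_def past_def by (rule subalgebra_inv_algebra_mono) (simp add: same_block_def)

text \<open>
  Events of the past do not change when the other coordinates are set to \<open>0\<close>, hence they are
  generated by the coordinates \<open>x i\<close> with \<open>i < 0\<close>.
\<close>

lemma past_generatedI:
  assumes coord: "\<And>i. i < 0 \<Longrightarrow> (\<lambda>x. x i) \<in> borel_measurable (sigma UNIV E)"
  shows "sets past \<subseteq> sigma_sets (space \<mu>) E"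
proof
  define N where "N = sigma (UNIV :: (int \<Rightarrow> real) set) E"
  have N: "space N = UNIV" "sets N = sigma_sets UNIV E" by (simp_all add: N_def)
  define p where "p x = (\<lambda>i. if i < 0 then x i else 0)" for x :: "int \<Rightarrow> real"
  have p: "p \<in> N \<rightarrow>\<^sub>M path_space"
    unfolding p_def
  proof (rule measurable_PiM_single')
    show "(\<lambda>x. if i < 0 then x i else 0) \<in> borel_measurable N" for i
      using coord[of i] unfolding N_def[symmetric] by (cases "i < 0") auto
  qed (auto simp: space_PiM)
  fix A assume "A \<in> sets past"
  then have A: "A \<in> sets \<mu>" "\<And>x y. \<forall>i<0. x i = y i \<Longrightarrow> x \<in> A \<longleftrightarrow> y \<in> A"
    by (auto simp: past_def sets_inv_algebra)
  have "x \<in> A \<longleftrightarrow> p x \<in> A" for x by (rule A(2)) (simp add: p_def)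
  then have "A = p -` A \<inter> space N" by (auto simp: N)
  also have "\<dots> \<in> sets N" using A(1) by (intro measurable_sets[OF p]) (simp add: sets_\<mu>)
  finally show "A \<in> sigma_sets (space \<mu>) E" by (simp add: N)
qed

text \<open>A quantized coordinate is part of the block at every late stage because \<open>\<lambda>\<^sub>k > k\<close>.\<close>

lemma past_generated_by_stages: "sets past \<subseteq> sigma_sets (space \<mu>) (\<Union>k. sets (stage k))"
proof (rule past_generatedI, rule measurable_sigma_sets[OF sigma_P_borel[symmetric]])
  fix i :: int and A assume i: "i < 0" and "A \<in> (\<Union>k\<in>{1..}. sigma_sets UNIV (\<P> k))"
  then obtain k where k: "k \<ge> 1" and A: "A \<in> sigma_sets UNIV (\<P> k)" by auto
  define n where "n = max k (nat (- i))"
  have "A \<in> sigma_sets UNIV (\<Union>k\<in>{1..}. sigma_sets UNIV (\<P> k))" using k A by blast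
  then have [measurable]: "A \<in> sets borel" unfolding sigma_P_borel .
  have "{x \<in> space \<mu>. x i \<in> A} \<in> sets \<mu>" by measurable
  moreover have "x i \<in> A \<longleftrightarrow> y i \<in> A" if "same_block n x y" for x y
  proof -
    have m: "1 \<le> nat (- i)" "- int (nat (- i)) = i" using i by auto
    have "enat (nat (- i)) \<le> enat (Suc n)" by (simp add: n_def)
    then have "enat (nat (- i)) \<le> lam \<P> x n" using lam_gt[of n \<P> x] by (rule order_trans)
    with that m(1) have "Q (Suc n) (x (- int (nat (- i)))) = Q (Suc n) (y (- int (nat (- i))))"
      unfolding same_block_def by blast
    then have "Q k (x i) = Q k (y i)" using k unfolding m(2) by (intro Q_refine[of k "Suc n"]) (auto simp: n_def)
    then show ?thesis by (rule sigma_sets_partition_invariant[OF partition_P[OF k] A])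
  qed
  ultimately have "{x. x i \<in> A} \<in> sets (stage n)" by (simp add: stage_def sets_inv_algebra)
  then show "(\<lambda>x. x i) -` A \<inter> space (sigma UNIV (\<Union>k. sets (stage k))) \<in> sets (sigma UNIV (\<Union>k. sets (stage k)))"
    unfolding vimage_def by auto
qed auto

text \<open>
  The value \<open>X\<^bsub>-\<tau>\<^esub>\<close> itself is not determined by the quantized block of the next stage, hence would not
  give an adapted sequence. Its quantization at the resolution used to find the recurrence does:
  the next block has length \<open>\<lambda>\<^bsub>k+1\<^esub> \<ge> \<tau>\<^bsub>k+1\<^esub>\<close> and a finer resolution.
\<close>

definition quantized_value :: "nat \<Rightarrow> (int \<Rightarrow> real) \<Rightarrow> real" where
  "quantized_value k x =
     (if tau \<P> x (Suc k) = \<infinity> then 0 else representative D k (x (- int (ret k x))))"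

lemma measurable_quantized_value: "quantized_value k \<in> borel_measurable (stage (Suc k))"
  unfolding stage_def
proof (rule measurable_inv_algebra)
  have [measurable]: "(\<lambda>x. tau \<P> x (Suc k)) \<in> \<mu> \<rightarrow>\<^sub>M count_space UNIV"
    by (rule measurable_\<mu>[OF measurable_tau]) simp
  have [measurable]: "(\<lambda>x. x (- int (ret k x))) \<in> borel_measurable \<mu>"
    unfolding ret_def by (rule measurable_\<mu>[OF measurable_recurrence_value]) simp
  show "quantized_value k \<in> borel_measurable \<mu>"
    unfolding quantized_value_def by measurable
  fix x y assume "same_block (Suc k) x y"
  then have *: "Q (Suc k) (x (- int n)) = Q (Suc k) (y (- int n))"
    if "1 \<le> n" "enat n \<le> lam \<P> x (Suc k)" for n
    using that by (intro Q_refine[of "Suc k" "Suc (Suc k)"]) (auto simp: same_block_def simp del: lam.simps(2))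
  have tau_eq: "tau \<P> y (Suc k) = tau \<P> x (Suc k)"
    by (rule lam_tau_cong(2)) (use * in auto)
  show "quantized_value k x = quantized_value k y"
  proof (cases "tau \<P> x (Suc k)")
    case (enat t)
    have "1 \<le> tau \<P> x (Suc k)" unfolding tau_def by (rule recurrence_time_ge_1)
    then have "1 \<le> t" by (simp add: enat one_enat_def)
    moreover have "enat t \<le> lam \<P> x (Suc k)" unfolding lam_Suc_tau enat by simp
    ultimately have "Q (Suc k) (x (- int t)) = Q (Suc k) (y (- int t))" by (rule *)
    then show ?thesis
      using enat tau_eq by (simp add: quantized_value_def ret_def representative_cong[of k "x _"])
  qed (simp add: quantized_value_def tau_eq)
qed

end

section \<open>Convergence of the backward estimator\<close>

context stationary_paths
begin

lemma AE_return_iff: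
  assumes "Measurable.pred \<mu> P"
  shows "(AE x in \<mu>. P (return k x)) \<longleftrightarrow> (AE x in \<mu>. P x)"
  using AE_distr_iff[OF measurable_return, of P k] assms unfolding distr_return by (simp add: pred_def)

lemma AE_return_bounded: "AE x in \<mu>. \<forall>k. \<bar>return k x 0\<bar> \<le> D"
proof -
  have "AE x in \<mu>. \<bar>return k x 0\<bar> \<le> D" for k
    using bounded_0 by (subst AE_return_iff[of "\<lambda>x. \<bar>x 0\<bar> \<le> D"]) auto
  then show ?thesis by (simp add: AE_all_countable)
qed

lemma quantized_value_eq:
  assumes "lam \<P> x (Suc k) \<noteq> \<infinity>"
  shows "quantized_value k x = representative D k (return k x 0)"
  using assms by (rule tau_finite) (simp add: quantized_value_def return_0)

lemma measurable_quantized_value_\<mu> [measurable]: "quantized_value k \<in> borel_measurable \<mu>"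
  by (rule measurable_from_subalg[OF subalgebra_stage measurable_quantized_value])

lemma abs_quantized_value_le: "\<bar>quantized_value k x\<bar> \<le> D"
  using D_nonneg abs_representative_le by (simp add: quantized_value_def)

lemma integrable_bounded:
  fixes f :: "(int \<Rightarrow> real) \<Rightarrow> real"
  assumes "f \<in> borel_measurable \<mu>" "\<And>x. \<bar>f x\<bar> \<le> c"
  shows "integrable \<mu> f"
  by (rule integrable_const_bound[where B = c]) (use assms in auto)

lemma integrable_0: "integrable \<mu> (\<lambda>x. x 0)"
  by (rule integrable_const_bound[where B = D]) (use bounded_0 in auto)

text \<open>
  Given the block, the quantized value at the recurrence has the same conditional expectation
  as the quantized \<open>X\<^sub>0\<close>: the return map preserves the measure and does not leave
  the events of the stage.
\<close>

lemma cond_exp_quantized_value: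
  "AE x in \<mu>. real_cond_exp \<mu> (stage k) (quantized_value k) x
     = real_cond_exp \<mu> (stage k) (\<lambda>x. representative D k (x 0)) x"
proof -
  interpret F: sigma_finite_subalgebra \<mu> "stage k" by (rule cond_exp_subalgebra[OF subalgebra_stage])
  let ?r = "\<lambda>x. representative D k (x 0)"
  have r_int: "integrable \<mu> ?r"
    by (rule integrable_bounded[of _ D]) (auto intro: abs_representative_le D_nonneg)
  show ?thesis
  proof (rule F.real_cond_exp_charact)
    fix A assume A: "A \<in> sets (stage k)"
    then have [measurable]: "A \<in> sets \<mu>" by (simp add: stage_def sets_inv_algebra)
    have "(\<integral>x\<in>A. quantized_value k x \<partial>\<mu>) = (\<integral>x. indicator A (return k x) *\<^sub>R ?r (return k x) \<partial>\<mu>)"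
      unfolding set_lebesgue_integral_def
    proof (rule integral_cong_AE)
      show "AE x in \<mu>. indicator A x *\<^sub>R quantized_value k x = indicator A (return k x) *\<^sub>R ?r (return k x)"
        using AE_lam_finite
      proof eventually_elim
        case (elim x)
        then have fin: "lam \<P> x (Suc k) \<noteq> \<infinity>" by blast
        have "x \<in> A \<longleftrightarrow> return k x \<in> A"
          using A same_block_return[OF fin] by (simp add: stage_def sets_inv_algebra)
        then show ?case by (simp add: quantized_value_eq[OF fin] indicator_def)
      qed
    qed measurable
    also have "\<dots> = (\<integral>x. indicator A x *\<^sub>R ?r x \<partial>distr \<mu> \<mu> (return k))"
      by (rule integral_distr[symmetric]) measurable
    also have "\<dots> = (\<integral>x\<in>A. ?r x \<partial>\<mu>)"
      unfolding distr_return set_lebesgue_integral_def ..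
    also have "\<dots> = (\<integral>x\<in>A. real_cond_exp \<mu> (stage k) ?r x \<partial>\<mu>)"
      by (rule F.real_cond_exp_intA[OF r_int A])
    finally show "(\<integral>x\<in>A. quantized_value k x \<partial>\<mu>) = (\<integral>x\<in>A. real_cond_exp \<mu> (stage k) ?r x \<partial>\<mu>)" .
  qed (auto intro!: F.real_cond_exp_int(1) r_int integrable_bounded[of _ D] abs_quantized_value_le)
qed

text \<open>
  Here \<open>representative D k (x 0)\<close> replaces \<open>quantized_value k\<close> in the conditional expectation, which
  changes it on a null set only.
\<close>

definition innovation :: "nat \<Rightarrow> (int \<Rightarrow> real) \<Rightarrow> real" where
  "innovation k x = quantized_value k x - real_cond_exp \<mu> (stage k) (\<lambda>x. representative D k (x 0)) x"

lemma measurable_innovation: "innovation k \<in> borel_measurable (stage (Suc k))"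
  unfolding innovation_def
  by (intro borel_measurable_diff measurable_quantized_value
      measurable_from_subalg[OF stage_mono borel_measurable_cond_exp]) simp

lemma AE_cond_exp_representative_bounded:
  "AE x in \<mu>. \<bar>real_cond_exp \<mu> (stage k) (\<lambda>x. representative D k (x 0)) x\<bar> \<le> D"
  by (rule cond_exp_bounded[OF subalgebra_stage]) (auto intro: abs_representative_le D_nonneg)

lemma AE_innovation_bounded: "AE x in \<mu>. \<bar>innovation k x\<bar> \<le> 2 * D"
  using AE_cond_exp_representative_bounded[of k]
proof eventually_elim
  case (elim x)
  with abs_quantized_value_le[of k x] show ?case by (simp add: innovation_def)
qed

text \<open>The innovations are martingale differences, hence orthogonal, and their averages vanish.\<close>

lemma innovation_averages: "AE x in \<mu>. (\<lambda>k. (\<Sum>j<k. innovation j x) / real k) \<longlonglongrightarrow> 0"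
proof (rule strong_law_orthogonal[OF _ AE_innovation_bounded])
  show inn [measurable]: "innovation n \<in> borel_measurable \<mu>" for n
    by (rule measurable_from_subalg[OF subalgebra_stage measurable_innovation])
  fix i j :: nat assume "i < j"
  interpret F: sigma_finite_subalgebra \<mu> "stage j" by (rule cond_exp_subalgebra[OF subalgebra_stage])
  let ?U = "real_cond_exp \<mu> (stage j) (\<lambda>x. representative D j (x 0))"
  have i_meas: "innovation i \<in> borel_measurable (stage j)"
    using \<open>i < j\<close> by (intro measurable_from_subalg[OF stage_mono measurable_innovation]) simp
  have int_q: "integrable \<mu> (\<lambda>x. innovation i x * quantized_value j x)"
  proof (rule integrable_const_bound[where B = "2 * D * D"])
    show "AE x in \<mu>. norm (innovation i x * quantized_value j x) \<le> 2 * D * D"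
      using AE_innovation_bounded[of i] by eventually_elim (simp add: abs_mult mult_mono abs_quantized_value_le)
  qed measurable
  have int_U: "integrable \<mu> (\<lambda>x. innovation i x * ?U x)"
  proof (rule integrable_const_bound[where B = "2 * D * D"])
    show "AE x in \<mu>. norm (innovation i x * ?U x) \<le> 2 * D * D"
      using AE_innovation_bounded[of i] AE_cond_exp_representative_bounded[of j]
      by eventually_elim (auto simp: abs_mult intro!: mult_mono)
  qed measurable
  have "expectation (\<lambda>x. innovation i x * quantized_value j x)
      = expectation (\<lambda>x. innovation i x * real_cond_exp \<mu> (stage j) (quantized_value j) x)"
    by (rule F.real_cond_exp_intg(2)[symmetric, OF int_q i_meas]) measurable
  also have "\<dots> = expectation (\<lambda>x. innovation i x * ?U x)"
  proof (rule integral_cong_AE)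
    show "AE x in \<mu>. innovation i x * real_cond_exp \<mu> (stage j) (quantized_value j) x = innovation i x * ?U x"
      using cond_exp_quantized_value[of j] by eventually_elim simp
  qed measurable
  finally show "expectation (\<lambda>x. innovation i x * innovation j x) = 0"
    unfolding innovation_def[of j] right_diff_distrib using int_q int_U by simp
qed

text \<open>
  The averages of the \<open>X\<^bsub>-\<tau>\<^esub>\<close> converge to the best predictor of \<open>X\<^sub>0\<close>. Each term is the
  innovation, plus a conditional expectation of \<open>X\<^sub>0\<close> given the block, plus two quantization errors
  that vanish with the mesh; the conditional expectations converge by Levy's theorem.
\<close>

lemma recurrence_averages:
  "AE x in \<mu>. (\<lambda>k. (\<Sum>j<k. return j x 0) / real k) \<longlonglongrightarrow> real_cond_exp \<mu> past (\<lambda>x. x 0) x"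
proof -
  define U where "U k = real_cond_exp \<mu> (stage k) (\<lambda>x. representative D k (x 0))" for k
  define V where "V k = real_cond_exp \<mu> (stage k) (\<lambda>x. x 0)" for k
  define err where "err k = (SUP x\<in>{x. \<bar>x\<bar> \<le> D}. \<bar>representative D k x - x\<bar>)" for k
  have rep_err: "\<bar>representative D k x - x\<bar> \<le> 2 * D" if "\<bar>x\<bar> \<le> D" for k x
    using that abs_representative_le[OF D_nonneg, of k x] by linarith
  have err: "\<bar>representative D k x - x\<bar> \<le> err k" if "\<bar>x\<bar> \<le> D" for k x
    unfolding err_def by (rule cSUP_upper) (use that rep_err in \<open>auto intro!: bdd_aboveI2\<close>)
  have err_0: "err \<longlonglongrightarrow> 0"
  proof (rule LIMSEQ_I)
    fix r :: real assume "r > 0"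
    then have "r / 2 > 0" by simp
    then obtain m where m: "\<And>k x y. k \<ge> m \<Longrightarrow> \<bar>x\<bar> \<le> D \<Longrightarrow> \<bar>y\<bar> \<le> D \<Longrightarrow> Q k x = Q k y \<Longrightarrow> \<bar>x - y\<bar> \<le> r / 2"
      by (rule mesh_tendsto_0[where D = D]) blast
    have "norm (err k - 0) < r" if "k \<ge> m" for k
    proof -
      have "err k \<le> r / 2"
        unfolding err_def
      proof (rule cSUP_least)
        show "{x. \<bar>x\<bar> \<le> D} \<noteq> {}" using D_nonneg by (auto intro: exI[of _ 0])
        show "\<bar>representative D k x - x\<bar> \<le> r / 2" if "x \<in> {x. \<bar>x\<bar> \<le> D}" for x
          using that \<open>k \<ge> m\<close>
          by (intro m[of "Suc k"]) (auto simp: Q_representative intro: abs_representative_le D_nonneg)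
      qed
      moreover have "0 \<le> err k" using err[of 0 k] D_nonneg by (simp add: order_trans[OF abs_ge_zero])
      ultimately show ?thesis using \<open>r > 0\<close> by simp
    qed
    then show "\<exists>no. \<forall>k\<ge>no. norm (err k - 0) < r" by blast
  qed
  have UV: "AE x in \<mu>. \<forall>k. \<bar>U k x - V k x\<bar> \<le> err k"
    unfolding AE_all_countable
  proof
    fix k
    interpret F: sigma_finite_subalgebra \<mu> "stage k" by (rule cond_exp_subalgebra[OF subalgebra_stage])
    have "AE x in \<mu>. \<bar>real_cond_exp \<mu> (stage k) (\<lambda>x. representative D k (x 0) - x 0) x\<bar> \<le> err k"
    proof (rule cond_exp_bounded[OF subalgebra_stage])
      show "AE x in \<mu>. \<bar>representative D k (x 0) - x 0\<bar> \<le> err k"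
        using bounded_0 by eventually_elim (rule err)
    qed measurable
    moreover have "AE x in \<mu>. real_cond_exp \<mu> (stage k) (\<lambda>x. representative D k (x 0) - x 0) x = U k x - V k x"
      unfolding U_def V_def
      by (intro F.real_cond_exp_diff integrable_0 integrable_bounded[of _ D] abs_representative_le D_nonneg) measurable
    ultimately show "AE x in \<mu>. \<bar>U k x - V k x\<bar> \<le> err k" by eventually_elim simp
  qed
  have V: "AE x in \<mu>. (\<lambda>k. V k x) \<longlonglongrightarrow> real_cond_exp \<mu> past (\<lambda>x. x 0) x"
    unfolding V_def
    by (intro levy_upward subalgebra_stage stage_mono subalgebra_past stage_le_past
        past_generated_by_stages integrable_0)
  show ?thesis
    using innovation_averages UV V AE_lam_finite AE_return_bounded
  proof eventually_elim
    case (elim x)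
    let ?Z = "real_cond_exp \<mu> past (\<lambda>x. x 0) x"
    have eq: "return j x 0 = innovation j x + ((return j x 0 - quantized_value j x) + (U j x - V j x) + V j x)" for j
      by (simp add: innovation_def U_def)
    have "(\<lambda>j. return j x 0 - quantized_value j x) \<longlonglongrightarrow> 0"
    proof (rule Lim_null_comparison[OF _ err_0], rule always_eventually, rule allI)
      fix j
      have "quantized_value j x = representative D j (return j x 0)"
        by (rule quantized_value_eq) (use elim(4) in blast)
      then show "norm (return j x 0 - quantized_value j x) \<le> err j"
        using err[of "return j x 0" j] elim(5) by (simp add: abs_minus_commute)
    qed
    moreover have "(\<lambda>j. U j x - V j x) \<longlonglongrightarrow> 0"
      by (rule Lim_null_comparison[OF _ err_0]) (use elim(2) in simp)
    ultimately have "(\<lambda>j. (return j x 0 - quantized_value j x) + (U j x - V j x) + V j x) \<longlonglongrightarrow> 0 + 0 + ?Z"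
      using elim(3) by (intro tendsto_add)
    then have "(\<lambda>k. (\<Sum>j<k. innovation j x) / real k
        + (\<Sum>j<k. (return j x 0 - quantized_value j x) + (U j x - V j x) + V j x) / real k) \<longlonglongrightarrow> 0 + ?Z"
      by (intro tendsto_add elim(1) cesaro_mean) simp
    then have lim: "(\<lambda>k. (\<Sum>j<k. innovation j x + ((return j x 0 - quantized_value j x) + (U j x - V j x) + V j x)) / real k)
        \<longlonglongrightarrow> ?Z"
      unfolding sum.distrib[of "\<lambda>j. innovation j x"] add_divide_distrib by simp
    show ?case using lim unfolding eq[symmetric] .
  qed
qed

lemma kappa_at_top:
  assumes "\<forall>k. lam \<P> x k \<noteq> \<infinity>"
  shows "filterlim (kappa \<P> x) at_top sequentially"
  unfolding filterlim_at_top
proof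
  fix k
  obtain n where n: "lam \<P> x k = enat n" using assms by blast
  show "\<forall>\<^sub>F t in sequentially. k \<le> kappa \<P> x t"
    using eventually_ge_at_top[of "max n 1"]
  proof eventually_elim
    case (elim t)
    then have "\<not> lam \<P> x (Suc (kappa \<P> x t)) \<le> enat t"
      using kappa_eq_iff[of t \<P> x "kappa \<P> x t"] by simp
    moreover have "lam \<P> x k \<le> enat t" using n elim by simp
    ultimately show ?case using lam_mono[of "Suc (kappa \<P> x t)" k \<P> x] by (meson not_less_eq_eq order_trans)
  qed
qed

lemma backward_estimator_eq:
  "backward_estimator \<P> t x = (\<Sum>j<kappa \<P> x t. return j x 0) / real (kappa \<P> x t)"
  unfolding backward_estimator_def return_0 ret_def
  by (simp add: sum.atLeast1_atMost_eq)

lemma backward_estimator_converges: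
  "AE x in \<mu>. (\<lambda>t. backward_estimator \<P> t x) \<longlonglongrightarrow> real_cond_exp \<mu> past (\<lambda>x. x 0) x"
  using recurrence_averages AE_lam_finite
proof eventually_elim
  case (elim x)
  show ?case
    unfolding backward_estimator_eq by (rule filterlim_compose[OF elim(1) kappa_at_top[OF elim(2)]])
qed

lemma AE_backward_estimator_bounded: "AE x in \<mu>. \<forall>t. \<bar>backward_estimator \<P> t x\<bar> \<le> D"
  using AE_return_bounded
proof eventually_elim
  case (elim x)
  show ?case
  proof
    fix t
    let ?k = "kappa \<P> x t"
    have "\<bar>\<Sum>j<?k. return j x 0\<bar> \<le> (\<Sum>j<?k. D)"
      by (rule order_trans[OF sum_abs sum_mono]) (use elim in auto)
    then show "\<bar>backward_estimator \<P> t x\<bar> \<le> D"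
      unfolding backward_estimator_eq using D_nonneg by (cases "?k = 0") (auto simp: field_simps)
  qed
qed

definition finite_past :: "nat \<Rightarrow> (int \<Rightarrow> real) measure" where
  "finite_past t = inv_algebra \<mu> (\<lambda>x y. \<forall>i\<in>{- int t..<0}. x i = y i)"

lemma subalgebra_finite_past: "subalgebra \<mu> (finite_past t)"
  unfolding finite_past_def by (rule subalgebra_inv_algebra)

lemma past_generated_by_finite_pasts: "sets past \<subseteq> sigma_sets (space \<mu>) (\<Union>t. sets (finite_past t))"
proof (rule past_generatedI, rule measurableI)
  fix i :: int and A :: "real set" assume i: "i < 0" and [measurable]: "A \<in> sets borel"
  have "{x \<in> space \<mu>. x i \<in> A} \<in> sets \<mu>" by measurable
  with i have "{x. x i \<in> A} \<in> sets (finite_past (nat (- i)))"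
    by (auto simp: finite_past_def sets_inv_algebra)
  then show "(\<lambda>x. x i) -` A \<inter> space (sigma UNIV (\<Union>t. sets (finite_past t)))
      \<in> sets (sigma UNIV (\<Union>t. sets (finite_past t)))"
    unfolding vimage_def by auto
qed auto

text \<open>
  The backward estimator and the predictor from the finite past have the same almost sure limit,
  the predictor from the infinite past; both are bounded, so their difference vanishes in \<open>L\<^sup>1\<close>.
\<close>

lemma backward_estimator_L1:
  "(\<lambda>t. expectation (\<lambda>x. \<bar>backward_estimator \<P> t x
      - real_cond_exp \<mu> (finite_past t) (\<lambda>x. x 0) x\<bar>)) \<longlonglongrightarrow> 0"
proof (subst filterlim_sequentially_Suc[symmetric])
  let ?Z = "real_cond_exp \<mu> past (\<lambda>x. x 0)"
  let ?C = "\<lambda>t. real_cond_exp \<mu> (finite_past t) (\<lambda>x. x 0)"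
  have [measurable]: "backward_estimator \<P> (Suc t) \<in> borel_measurable \<mu>" for t
    by (rule measurable_\<mu>[OF measurable_backward_estimator]) simp
  have C_lim: "AE x in \<mu>. (\<lambda>t. ?C t x) \<longlonglongrightarrow> ?Z x"
  proof (intro levy_upward subalgebra_finite_past subalgebra_past past_generated_by_finite_pasts integrable_0)
    show "subalgebra (finite_past n) (finite_past m)" if "m \<le> n" for m n
      unfolding finite_past_def using that by (intro subalgebra_inv_algebra_mono) auto
    show "subalgebra past (finite_past n)" for n
      unfolding finite_past_def past_def by (rule subalgebra_inv_algebra_mono) auto
  qed
  have "AE x in \<mu>. \<bar>?C t x\<bar> \<le> D" for t
    by (rule cond_exp_bounded[OF subalgebra_finite_past _ bounded_0]) measurable
  then have C_bd: "AE x in \<mu>. \<forall>t. \<bar>?C t x\<bar> \<le> D" by (simp add: AE_all_countable)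
  have "(\<lambda>t. expectation (\<lambda>x. \<bar>backward_estimator \<P> (Suc t) x - ?C (Suc t) x\<bar>)) \<longlonglongrightarrow> expectation (\<lambda>x. 0)"
  proof (rule integral_dominated_convergence[where w = "\<lambda>x. 2 * D"])
    show "AE x in \<mu>. (\<lambda>t. \<bar>backward_estimator \<P> (Suc t) x - ?C (Suc t) x\<bar>) \<longlonglongrightarrow> 0"
      using backward_estimator_converges C_lim
    proof eventually_elim
      case (elim x)
      then have "(\<lambda>t. \<bar>backward_estimator \<P> t x - ?C t x\<bar>) \<longlonglongrightarrow> \<bar>?Z x - ?Z x\<bar>"
        by (intro tendsto_intros)
      then show ?case by (intro LIMSEQ_Suc) simp
    qed
    show "AE x in \<mu>. norm \<bar>backward_estimator \<P> (Suc t) x - ?C (Suc t) x\<bar> \<le> 2 * D" for t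
      using AE_backward_estimator_bounded C_bd
    proof eventually_elim
      case (elim x)
      then have "\<bar>backward_estimator \<P> (Suc t) x\<bar> \<le> D" "\<bar>?C (Suc t) x\<bar> \<le> D" by blast+
      then show ?case by (simp add: abs_le_iff)
    qed
  qed measurable
  then show "(\<lambda>t. expectation (\<lambda>x. \<bar>backward_estimator \<P> (Suc t) x - ?C (Suc t) x\<bar>)) \<longlonglongrightarrow> 0" by simp
qed

end

section \<open>From the path space to the process\<close>

lemma borel_measurable_inv_algebra_cong:
  fixes f :: "'a \<Rightarrow> real"
  assumes f: "f \<in> borel_measurable (inv_algebra M R)"
    and "R x y" "x \<in> space M" "y \<in> space M"
  shows "f x = f y"
proof -
  have "f -` {f x} \<inter> space (inv_algebra M R) \<in> sets (inv_algebra M R)"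
    by (rule measurable_sets[OF f]) simp
  then have "x \<in> f -` {f x} \<inter> space M \<longleftrightarrow> y \<in> f -` {f x} \<inter> space M"
    using assms(2-4) unfolding sets_inv_algebra space_inv_algebra by blast
  then show ?thesis using assms(3,4) by simp
qed

lemma measurable_sample_path:
  assumes "\<And>n. X n \<in> borel_measurable M"
  shows "sample_path X \<in> M \<rightarrow>\<^sub>M path_space"
proof -
  have "(\<lambda>\<omega> n. X n \<omega>) \<in> M \<rightarrow>\<^sub>M path_space"
    by (rule measurable_PiM_single') (use assms in \<open>auto simp: space_PiM\<close>)
  then show ?thesis by (simp add: sample_path_def[abs_def])
qed

lemma measurable_left_shift_funpow: "left_shift ^^ t \<in> path_space \<rightarrow>\<^sub>M path_space"
  by (rule measurable_compose_n[OF measurable_left_shift])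

lemma distr_shifted_path:
  assumes X: "\<And>n. X n \<in> borel_measurable M" and stat: "stationary M X"
  shows "distr M path_space (\<lambda>\<omega>. (left_shift ^^ t) (sample_path X \<omega>)) = distr M path_space (sample_path X)"
proof -
  let ?\<mu> = "distr M path_space (sample_path X)"
  note sp = measurable_sample_path[OF X]
  have T: "left_shift \<in> ?\<mu> \<rightarrow>\<^sub>M ?\<mu>" using measurable_left_shift by simp
  have "distr ?\<mu> ?\<mu> left_shift = distr ?\<mu> path_space left_shift" by (rule distr_cong) auto
  also have "\<dots> = ?\<mu>"
    using stat by (subst distr_distr[OF measurable_left_shift sp]) (simp add: stationary_def comp_def)
  finally have "distr ?\<mu> ?\<mu> (left_shift ^^ t) = ?\<mu>" by (rule distr_funpow_self[OF T])
  moreover have "distr ?\<mu> ?\<mu> (left_shift ^^ t) = distr ?\<mu> path_space (left_shift ^^ t)"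
    by (rule distr_cong) auto
  ultimately show ?thesis
    by (subst (asm) distr_distr[OF measurable_left_shift_funpow sp]) (simp add: comp_def)
qed

text \<open>
  Conditioning on \<open>X\<^sub>0, \<dots>, X\<^bsub>t-1\<^esub>\<close> is conditioning on the coordinates \<open>-t, \<dots>, -1\<close> of the path
  shifted by \<open>t\<close>.
\<close>

lemma (in stationary_paths) cond_exp_sigma_past:
  assumes M: "prob_space M" and X: "\<And>n. X n \<in> borel_measurable M" and stat: "stationary M X"
    and \<mu>: "\<mu> = distr M path_space (sample_path X)"
  shows "AE \<omega> in M. real_cond_exp M (sigma_past M X t) (X (int t)) \<omega>
     = real_cond_exp \<mu> (finite_past t) (\<lambda>x. x 0) ((left_shift ^^ t) (sample_path X \<omega>))"
proof -
  interpret M: prob_space M by (rule M)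
  interpret P: sigma_finite_subalgebra \<mu> "finite_past t"
    by (rule cond_exp_subalgebra[OF subalgebra_finite_past])
  let ?I = "{0..<int t}"
  define \<psi> where "\<psi> \<omega> = (left_shift ^^ t) (sample_path X \<omega>)" for \<omega>
  define C where "C = real_cond_exp \<mu> (finite_past t) (\<lambda>x. x 0)"
  have \<psi>_i: "\<psi> \<omega> i = X (i + int t) \<omega>" for \<omega> i
    by (simp add: \<psi>_def left_shift_funpow sample_path_def)
  have \<psi>_path: "\<psi> \<in> M \<rightarrow>\<^sub>M path_space"
    unfolding \<psi>_def
    by (rule measurable_compose[OF measurable_sample_path[OF X] measurable_left_shift_funpow])
  then have \<psi> [measurable]: "\<psi> \<in> M \<rightarrow>\<^sub>M \<mu>" using measurable_cong_sets[OF refl sets_\<mu>] by blast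
  have \<psi>_distr: "distr M \<mu> \<psi> = \<mu>"
  proof -
    have "distr M \<mu> \<psi> = distr M path_space \<psi>" by (rule distr_cong) (auto simp: sets_\<mu>)
    then show ?thesis unfolding \<psi>_def[abs_def] distr_shifted_path[OF X stat] \<mu>[symmetric] .
  qed
  have C_meas: "C \<in> borel_measurable (finite_past t)" unfolding C_def by measurable
  have [measurable]: "C \<in> borel_measurable \<mu>" unfolding C_def by measurable
  have C_int: "integrable \<mu> C" unfolding C_def by (rule P.real_cond_exp_int[OF integrable_0])
  have restr [measurable]: "(\<lambda>\<omega>. \<lambda>i\<in>?I. X i \<omega>) \<in> M \<rightarrow>\<^sub>M PiM ?I (\<lambda>_. borel)"
    by (rule measurable_restrict) (rule X)
  have sub: "subalgebra M (sigma_past M X t)"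
    using measurable_sets[OF restr]
    by (auto simp: subalgebra_def sigma_past_def sets_vimage_algebra2 space_PiM)
  interpret S: sigma_finite_subalgebra M "sigma_past M X t" by (rule M.cond_exp_subalgebra[OF sub])
  have "AE \<omega> in M. real_cond_exp M (sigma_past M X t) (X (int t)) \<omega> = C (\<psi> \<omega>)"
  proof (rule S.real_cond_exp_charact)
    fix A assume A: "A \<in> sets (sigma_past M X t)"
    then obtain B where B: "B \<in> sets (PiM ?I (\<lambda>_. borel))" "A = (\<lambda>\<omega>. \<lambda>i\<in>?I. X i \<omega>) -` B \<inter> space M"
      by (auto simp: sigma_past_def sets_vimage_algebra2 space_PiM)
    define A' where "A' = {x. (\<lambda>i\<in>?I. x (i - int t)) \<in> B}"
    have "(\<lambda>x. \<lambda>i\<in>?I. x (i - int t)) \<in> \<mu> \<rightarrow>\<^sub>M PiM ?I (\<lambda>_. borel)"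
      by (rule measurable_restrict) measurable
    from measurable_sets[OF this B(1)] have A'_\<mu> [measurable]: "A' \<in> sets \<mu>"
      by (simp add: A'_def vimage_def)
    have "x \<in> A' \<longleftrightarrow> y \<in> A'" if "\<forall>i\<in>{- int t..<0}. x i = y i" for x y
    proof -
      have "(\<lambda>i\<in>?I. x (i - int t)) = (\<lambda>i\<in>?I. y (i - int t))"
        using that by (intro restrict_ext) auto
      then show ?thesis by (simp add: A'_def)
    qed
    with A'_\<mu> have A'_past: "A' \<in> sets (finite_past t)" by (simp add: finite_past_def sets_inv_algebra)
    have A_iff: "\<omega> \<in> A \<longleftrightarrow> \<psi> \<omega> \<in> A'" if "\<omega> \<in> space M" for \<omega>
      using that by (simp add: B(2) A'_def \<psi>_i)
    have transfer: "(\<integral>\<omega>\<in>A. g (\<psi> \<omega>) \<partial>M) = (\<integral>x\<in>A'. g x \<partial>\<mu>)"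
      if [measurable]: "g \<in> borel_measurable \<mu>" for g :: "(int \<Rightarrow> real) \<Rightarrow> real"
    proof -
      have "(\<integral>\<omega>\<in>A. g (\<psi> \<omega>) \<partial>M) = (\<integral>\<omega>. indicator A' (\<psi> \<omega>) *\<^sub>R g (\<psi> \<omega>) \<partial>M)"
        unfolding set_lebesgue_integral_def
        by (intro Bochner_Integration.integral_cong) (auto simp: A_iff indicator_def)
      also have "\<dots> = (\<integral>x. indicator A' x *\<^sub>R g x \<partial>distr M \<mu> \<psi>)"
        by (rule integral_distr[symmetric]) measurable
      finally show ?thesis unfolding \<psi>_distr set_lebesgue_integral_def .
    qed
    have "(\<integral>\<omega>\<in>A. X (int t) \<omega> \<partial>M) = (\<integral>x\<in>A'. x 0 \<partial>\<mu>)"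
      using transfer[of "\<lambda>x. x 0"] by (simp add: \<psi>_i)
    also have "\<dots> = (\<integral>x\<in>A'. C x \<partial>\<mu>)"
      unfolding C_def by (rule P.real_cond_exp_intA[OF integrable_0 A'_past])
    also have "\<dots> = (\<integral>\<omega>\<in>A. C (\<psi> \<omega>) \<partial>M)" by (rule transfer[symmetric]) measurable
    finally show "(\<integral>\<omega>\<in>A. X (int t) \<omega> \<partial>M) = (\<integral>\<omega>\<in>A. C (\<psi> \<omega>) \<partial>M)" .
  next
    have "integrable (distr M \<mu> \<psi>) (\<lambda>x. x 0)" unfolding \<psi>_distr by (rule integrable_0)
    then show "integrable M (X (int t))"
      by (subst (asm) integrable_distr_eq) (auto simp: \<psi>_i)
    have "integrable (distr M \<mu> \<psi>) C" unfolding \<psi>_distr by (rule C_int)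
    then show "integrable M (\<lambda>\<omega>. C (\<psi> \<omega>))"
      by (subst (asm) integrable_distr_eq) auto
    \<comment> \<open>\<open>C\<close> only depends on the coordinates \<open>-t, \<dots>, -1\<close>, so the others may be replaced by \<open>0\<close>.\<close>
    define ext where "ext y = (\<lambda>i. if i \<in> {- int t..<0} then y (i + int t) else 0)" for y :: "int \<Rightarrow> real"
    have ext: "ext \<in> PiM ?I (\<lambda>_. borel) \<rightarrow>\<^sub>M path_space"
      unfolding ext_def
    proof (rule measurable_PiM_single')
      show "(\<lambda>y. if i \<in> {- int t..<0} then y (i + int t) else 0) \<in> borel_measurable (PiM ?I (\<lambda>_. borel))" for i
        by (cases "i \<in> {- int t..<0}") (auto intro!: measurable_component_singleton)
    qed (auto simp: space_PiM)
    have eq: "C (\<psi> \<omega>) = C (ext (\<lambda>i\<in>?I. X i \<omega>))" for \<omega>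
      by (rule borel_measurable_inv_algebra_cong[OF C_meas[unfolded finite_past_def]])
         (auto simp: ext_def \<psi>_i)
    have past: "(\<lambda>\<omega>. \<lambda>i\<in>?I. X i \<omega>) \<in> sigma_past M X t \<rightarrow>\<^sub>M PiM ?I (\<lambda>_. borel)"
      unfolding sigma_past_def by (rule measurable_vimage_algebra1) (auto simp: space_PiM)
    have C_path: "C \<in> borel_measurable path_space"
      using \<open>C \<in> borel_measurable \<mu>\<close> measurable_cong_sets[OF sets_\<mu> refl] by blast
    show "(\<lambda>\<omega>. C (\<psi> \<omega>)) \<in> borel_measurable (sigma_past M X t)"
      unfolding eq by (rule measurable_compose[OF measurable_compose[OF past ext] C_path])
  qed
  then show ?thesis unfolding C_def \<psi>_def .
qed

lemma tendsto_0_L1_imp_in_prob: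
  assumes "prob_space M" and Y: "tendsto_0_L1 M Y"
  shows "tendsto_0_in_prob M Y"
  unfolding tendsto_0_in_prob_def
proof (intro conjI allI impI)
  interpret prob_space M by (rule assms)
  have int: "integrable M (Y t)" if "t \<ge> 1" for t using Y that by (simp add: tendsto_0_L1_def)
  then show "Y t \<in> borel_measurable M" if "t \<ge> 1" for t using that by blast
  fix \<epsilon> :: real assume \<epsilon>: "\<epsilon> > 0"
  have "(\<lambda>t. expectation (\<lambda>\<omega>. \<bar>Y t \<omega>\<bar>) / \<epsilon>) \<longlonglongrightarrow> 0 / \<epsilon>"
    using Y \<epsilon> by (intro tendsto_divide) (auto simp: tendsto_0_L1_def)
  then have lim: "(\<lambda>t. expectation (\<lambda>\<omega>. \<bar>Y t \<omega>\<bar>) / \<epsilon>) \<longlonglongrightarrow> 0" by simp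
  show "(\<lambda>t. prob {\<omega> \<in> space M. \<bar>Y t \<omega>\<bar> > \<epsilon>}) \<longlonglongrightarrow> 0"
  proof (rule Lim_null_comparison[OF _ lim])
    show "\<forall>\<^sub>F t in sequentially. norm (prob {\<omega> \<in> space M. \<bar>Y t \<omega>\<bar> > \<epsilon>}) \<le> expectation (\<lambda>\<omega>. \<bar>Y t \<omega>\<bar>) / \<epsilon>"
      using eventually_ge_at_top[of 1]
    proof eventually_elim
      case (elim t)
      note [measurable] = borel_measurable_integrable[OF int[OF elim]]
      have "prob {\<omega> \<in> space M. \<bar>Y t \<omega>\<bar> > \<epsilon>} \<le> prob {\<omega> \<in> space M. \<epsilon> \<le> \<bar>Y t \<omega>\<bar>}"
        by (rule finite_measure_mono) auto
      also have "\<dots> \<le> expectation (\<lambda>\<omega>. \<bar>Y t \<omega>\<bar>) / \<epsilon>"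
        by (rule integral_Markov_inequality_measure[of M _ "{}"]) (use int[OF elim] \<epsilon> in auto)
      finally show ?case by simp
    qed
  qed
qed

text \<open>
  What remains is to read the statement on the path space: shifting the sample path by \<open>t\<close> turns the
  on-line predictor into the backward estimator and preserves the distribution.
\<close>

theorem mainTheorem4:
  fixes M :: "'a measure" and X :: "int \<Rightarrow> 'a \<Rightarrow> real"
    and \<P> :: "nat \<Rightarrow> real set set" and D :: real
  assumes "prob_space M"
    and "\<And>n. X n \<in> borel_measurable M"
    and "stationary M X"
    and "ergodic M X"
    and "AE \<omega> in M. \<bar>X 0 \<omega>\<bar> \<le> D"
    and "generating_partitions \<P>"
  shows "tendsto_0_L1 M
           (\<lambda>t \<omega>. online_predictor \<P> X t \<omega> - real_cond_exp M (sigma_past M X t) (X (int t)) \<omega>) \<and>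
         tendsto_0_in_prob M
           (\<lambda>t \<omega>. online_predictor \<P> X t \<omega> - real_cond_exp M (sigma_past M X t) (X (int t)) \<omega>)"
proof -
  interpret M: prob_space M by (rule assms)
  note X [measurable] = assms(2)
  note sp = measurable_sample_path[OF X]
  define \<mu> where "\<mu> = distr M path_space (sample_path X)"
  interpret \<mu>: prob_space \<mu> unfolding \<mu>_def by (rule M.prob_space_distr[OF sp])
  interpret stationary_paths \<P> \<mu> D
  proof
    show "generating_partitions \<P>" by (rule assms)
    show "sets \<mu> = sets path_space" by (simp add: \<mu>_def)
    have "distr \<mu> \<mu> left_shift = distr \<mu> path_space left_shift" by (rule distr_cong) (auto simp: \<mu>_def)
    also have "\<dots> = \<mu>"
      using assms(3) unfolding \<mu>_def
      by (subst distr_distr[OF measurable_left_shift sp]) (simp add: stationary_def comp_def)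
    finally show "distr \<mu> \<mu> left_shift = \<mu>" .
    show "AE x in \<mu>. \<bar>x 0\<bar> \<le> D"
      unfolding \<mu>_def
    proof (subst AE_distr_iff[OF sp])
      show "{x \<in> space path_space. \<bar>x 0\<bar> \<le> D} \<in> sets path_space"
        using partitions.measurable_coordinate by measurable
    qed (use assms(5) in \<open>simp add: sample_path_def\<close>)
  qed
  define \<psi> where "\<psi> t \<omega> = (left_shift ^^ t) (sample_path X \<omega>)" for t \<omega>
  have \<psi>_path: "\<psi> t \<in> M \<rightarrow>\<^sub>M path_space" for t
    unfolding \<psi>_def by (rule measurable_compose[OF sp measurable_left_shift_funpow])
  have \<psi> [measurable]: "\<psi> t \<in> M \<rightarrow>\<^sub>M \<mu>" for t
    using \<psi>_path measurable_cong_sets[OF refl sets_\<mu>] by blast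
  have \<psi>_distr: "distr M \<mu> (\<psi> t) = \<mu>" for t
  proof -
    have "distr M \<mu> (\<psi> t) = distr M path_space (\<psi> t)" by (rule distr_cong) (auto simp: sets_\<mu>)
    then show ?thesis unfolding \<psi>_def[abs_def] distr_shifted_path[OF X assms(3)] \<mu>_def[symmetric] .
  qed
  let ?C = "\<lambda>t. real_cond_exp \<mu> (finite_past t) (\<lambda>x. x 0)"
  define Y where "Y t \<omega> = online_predictor \<P> X t \<omega> - real_cond_exp M (sigma_past M X t) (X (int t)) \<omega>" for t \<omega>
  define Y' where "Y' t x = backward_estimator \<P> t x - ?C t x" for t x
  have Y_eq: "AE \<omega> in M. Y t \<omega> = Y' t (\<psi> t \<omega>)" for t
    using cond_exp_sigma_past[OF assms(1) X assms(3) \<mu>_def, of t]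
    by eventually_elim (simp add: Y_def Y'_def online_predictor_def \<psi>_def)
  have Y'_meas [measurable]: "Y' t \<in> borel_measurable \<mu>" if "t \<ge> 1" for t
    using measurable_\<mu>[OF measurable_backward_estimator[OF that]] unfolding Y'_def by measurable
  have Y_meas [measurable]: "Y t \<in> borel_measurable M" if "t \<ge> 1" for t
  proof -
    have "(\<lambda>\<omega>. online_predictor \<P> X t \<omega>) \<in> borel_measurable M"
      unfolding online_predictor_def \<psi>_def[symmetric]
      by (rule measurable_compose[OF \<psi>_path measurable_backward_estimator[OF that]])
    then show ?thesis unfolding Y_def by measurable
  qed
  have Y'_int: "integrable \<mu> (Y' t)" if "t \<ge> 1" for t
  proof (rule \<mu>.integrable_const_bound[where B = "2 * D"])
    have "AE x in \<mu>. \<bar>?C t x\<bar> \<le> D"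
      by (rule \<mu>.cond_exp_bounded[OF subalgebra_finite_past _ bounded_0]) measurable
    then show "AE x in \<mu>. norm (Y' t x) \<le> 2 * D"
      using AE_backward_estimator_bounded
    proof eventually_elim
      case (elim x)
      then have "\<bar>backward_estimator \<P> t x\<bar> \<le> D" "\<bar>?C t x\<bar> \<le> D" by blast+
      then show ?case by (simp add: Y'_def abs_le_iff)
    qed
  qed (rule Y'_meas[OF that])
  have int: "integrable M (Y t)" if "t \<ge> 1" for t
  proof -
    have "integrable (distr M \<mu> (\<psi> t)) (Y' t)" unfolding \<psi>_distr by (rule Y'_int[OF that])
    then have "integrable M (\<lambda>\<omega>. Y' t (\<psi> t \<omega>))"
      by (subst (asm) integrable_distr_eq) (use Y'_meas[OF that] in auto)
    moreover have "AE \<omega> in M. Y' t (\<psi> t \<omega>) = Y t \<omega>" using Y_eq[of t] by eventually_elim simp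
    ultimately show ?thesis using Y_meas[OF that] integrable_cong_AE_imp by blast
  qed
  have "(\<integral>\<omega>. \<bar>Y t \<omega>\<bar> \<partial>M) = (\<integral>x. \<bar>Y' t x\<bar> \<partial>\<mu>)" if t: "t \<ge> 1" for t
  proof -
    note [measurable] = Y'_meas[OF t] Y_meas[OF t]
    have "(\<integral>\<omega>. \<bar>Y t \<omega>\<bar> \<partial>M) = (\<integral>\<omega>. \<bar>Y' t (\<psi> t \<omega>)\<bar> \<partial>M)"
    proof (rule integral_cong_AE)
      show "AE \<omega> in M. \<bar>Y t \<omega>\<bar> = \<bar>Y' t (\<psi> t \<omega>)\<bar>" using Y_eq[of t] by eventually_elim simp
    qed measurable
    also have "\<dots> = (\<integral>x. \<bar>Y' t x\<bar> \<partial>distr M \<mu> (\<psi> t))" by (rule integral_distr[symmetric]) measurable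
    finally show ?thesis unfolding \<psi>_distr .
  qed
  then have "\<forall>\<^sub>F t in sequentially. (\<integral>x. \<bar>Y' t x\<bar> \<partial>\<mu>) = (\<integral>\<omega>. \<bar>Y t \<omega>\<bar> \<partial>M)"
    by (intro eventually_mono[OF eventually_ge_at_top[of 1]]) (rule sym)
  with backward_estimator_L1 have "(\<lambda>t. \<integral>\<omega>. \<bar>Y t \<omega>\<bar> \<partial>M) \<longlonglongrightarrow> 0"
    unfolding Y'_def by (rule Lim_transform_eventually)
  with int have "tendsto_0_L1 M Y" by (simp add: tendsto_0_L1_def)
  with tendsto_0_L1_imp_in_prob[OF assms(1) this] show ?thesis
    unfolding Y_def[abs_def] by blast
qed

end
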